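(* Let $i:Z\hookrightarrow X$ be a regular or normally oriented closed immersion of real codimension $2r$, with open complement $j:U\hookrightarrow X$ and oriented normal object $N\to Z$ with sphere bundle $\pi:S(N)\to Z$. Assume the purity, excision, orientation and Gysin hypotheses listed in the context, and suppose that, after passing to a chosen coefficient localisation, or to a periodic or twisted coefficient theory, multiplication by the Euler class $e(N)$ is an isomorphism in the relevant degrees ($H^{d-2r}(Z;i^*A)\to H^d(Z;i^*A)$). Let $c\in H^d(X;A)$ be a class with $j^*c=0$. Then in the localised theory the link-transgression secondary group $\mathrm{im}\bigl(\delta:H^{d-1}(U;j^*A)\to H_Z^d(X;A)\bigr)$ vanishes. Consequently the localisation torsor of $c$ has a single element, and the corresponding localised class is the Euler-divided class: under the Thom isomorphism $H^{d-2r}(Z;i^*A)\cong H_Z^d(X;A)$ the unique supported refinement of $c$ corresponds to $i^*c/e(N)$, the unique class $\gamma\in H^{d-2r}(Z;i^*A)$ with $\gamma\cup e(N)=i^*c$.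
   Context: Setting: each space $X$ has a stable triangulated symmetric monoidal category $\mathcal C(X)$ with unit $\mathbf 1_X$, and functors $f^*\dashv f_*$ with $f^*$ symmetric monoidal. For the closed immersion $i:Z\hookrightarrow X$ with open complement $j:U\hookrightarrow X$ the recollement axioms hold: $i^*\dashv i_*\dashv i^!$, $j_!\dashv j^*\dashv j_*$, $i_*,j_!$ fully faithful, $j^*i_*=0$, $i^*j_!=0$, and functorial distinguished triangles $j_!j^*M\to M\to i_*i^*M\xrightarrow{+1}$, $i_*i^!M\to M\to j_*j^*M\xrightarrow{+1}$. Put $H^d(X;A)=\mathrm{Hom}(\mathbf 1_X,A[d])$ and $H^d_Z(X;A)=\mathrm{Hom}(\mathbf 1_X,i_*i^!A[d])$. The localisation long exact sequence is $\cdots\to H_Z^d(X;A)\xrightarrow{\mathrm{forg}}H^d(X;A)\xrightarrow{j^*}H^d(U;j^*A)\xrightarrow{\delta}H_Z^{d+1}(X;A)\to\cdots$, obtained from the triangle $i_*i^!A\to A\to j_*j^*A\xrightarrow{+1}$. The set of supported refinements is $\mathrm{Lift}_Z^d(c)=\{\widetilde c\in H_Z^d(X;A):\mathrm{forg}(\widetilde c)=c\}$. The localisation torsor is its image under the adjunction isomorphism $H_Z^d(X;A)\cong\mathrm{Hom}_{\mathcal C(Z)}(\mathbf 1_Z,i^!A[d])$; when it is a singleton its element is the localised class. Standing hypotheses (holding in the coefficient theory in which Euler multiplication is an isomorphism): (1) Excision / tubular neighbourhood: one may work in a tubular neighbourhood of $Z$ and replace the pair $(X,U)$ (and its localisation sequence)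 by the disk-bundle pair $(D(N),D(N)\setminus Z)$, where $D(N)\setminus Z$ retracts onto the sphere bundle $S(N)$. (2) Thom isomorphism: $\mathrm{Th}_i:H^{k-2r}(Z;i^*A)\xrightarrow{\sim}H_Z^k(X;A)$ for all $k$, with self-intersection formula $i^*\,\mathrm{forg}(\mathrm{Th}_i(\beta))=\beta\cup e(N)$. (3) Exact Gysin sequence of the oriented sphere bundle $\pi:S(N)\to Z$: $$\cdots\to H^{k-1}(S(N);\pi^*i^*A)\xrightarrow{\pi_*}H^{k-2r}(Z;i^*A)\xrightarrow{\cup e(N)}H^{k}(Z;i^*A)\xrightarrow{\pi^*}H^{k}(S(N);\pi^*i^*A)\to\cdots$$ (4) After the excision (1) and the Thom identification (2), the localisation triangle of the pair $(D(N),D(N)\setminus Z)$ is identified with the Gysin triangle of $S(N)\to Z$. Thus $\mathrm{forg}$ corresponds to $\cup e(N)$, restriction to the open complement to $\pi^*$, and $\delta$ to $\pi_*$. *)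

theory Defs
  imports "HOL-Algebra.Coset"
begin

section \<open>Categories\<close>

record ('o, 'm) category =
  Obj :: "'o set"
  Arr :: "'m set"
  src :: "'m \<Rightarrow> 'o"
  trg :: "'m \<Rightarrow> 'o"
  idt :: "'o \<Rightarrow> 'm"
  cmp :: "'m \<Rightarrow> 'm \<Rightarrow> 'm" (infixr "\<cdot>\<index>" 70)

definition Hom :: "('o, 'm, 'z) category_scheme \<Rightarrow> 'o \<Rightarrow> 'o \<Rightarrow> 'm set" where
  "Hom C a b = {f \<in> Arr C. src C f = a \<and> trg C f = b}"

locale category =
  fixes C :: "('o, 'm, 'z) category_scheme" (structure)
  assumes src_Obj: "f \<in> Arr C \<Longrightarrow> src C f \<in> Obj C"
    and trg_Obj: "f \<in> Arr C \<Longrightarrow> trg C f \<in> Obj C"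
    and idt_Hom: "a \<in> Obj C \<Longrightarrow> idt C a \<in> Hom C a a"
    and cmp_Hom: "f \<in> Hom C a b \<Longrightarrow> g \<in> Hom C b c \<Longrightarrow> g \<cdot> f \<in> Hom C a c"
    and idt_left: "f \<in> Hom C a b \<Longrightarrow> idt C b \<cdot> f = f"
    and idt_right: "f \<in> Hom C a b \<Longrightarrow> f \<cdot> idt C a = f"
    and cmp_assoc: "f \<in> Hom C a b \<Longrightarrow> g \<in> Hom C b c \<Longrightarrow> h \<in> Hom C c d \<Longrightarrow>
      (h \<cdot> g) \<cdot> f = h \<cdot> (g \<cdot> f)"

definition inverse_arrows :: "('o, 'm, 'z) category_scheme \<Rightarrow> 'm \<Rightarrow> 'm \<Rightarrow> bool" where
  "inverse_arrows C f g \<longleftrightarrow> f \<in> Arr C \<and> g \<in> Hom C (trg C f) (src C f) \<and>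
     g \<cdot>\<^bsub>C\<^esub> f = idt C (src C f) \<and> f \<cdot>\<^bsub>C\<^esub> g = idt C (trg C f)"

definition is_iso :: "('o, 'm, 'z) category_scheme \<Rightarrow> 'm \<Rightarrow> bool" where
  "is_iso C f \<longleftrightarrow> (\<exists>g. inverse_arrows C f g)"

definition inv_arr :: "('o, 'm, 'z) category_scheme \<Rightarrow> 'm \<Rightarrow> 'm" where
  "inv_arr C f = (THE g. inverse_arrows C f g)"

definition is_zero :: "('o, 'm, 'z) category_scheme \<Rightarrow> 'o \<Rightarrow> bool" where
  "is_zero C z \<longleftrightarrow> z \<in> Obj C \<and>
     (\<forall>a \<in> Obj C. (\<exists>!f. f \<in> Hom C a z) \<and> (\<exists>!f. f \<in> Hom C z a))"

section \<open>Triangulated categories\<close>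

text \<open>Hom sets are pairwise disjoint, so one operation \<open>addm\<close> on arrows carries the addition of
  every Hom group. Hom groups are written as \<open>monoid\<close> records to use the group theory of
  HOL-Algebra; their neutral element is the zero arrow.\<close>

record ('o, 'm) additive_category = "('o, 'm) category" +
  addm :: "'m \<Rightarrow> 'm \<Rightarrow> 'm"
  zerom :: "'o \<Rightarrow> 'o \<Rightarrow> 'm"

definition HomG :: "('o, 'm, 'z) additive_category_scheme \<Rightarrow> 'o \<Rightarrow> 'o \<Rightarrow> 'm monoid" where
  "HomG C a b = \<lparr>carrier = Hom C a b, monoid.mult = addm C, one = zerom C a b\<rparr>"

definition negm :: "('o, 'm, 'z) additive_category_scheme \<Rightarrow> 'm \<Rightarrow> 'm" where
  "negm C f = inv\<^bsub>HomG C (src C f) (trg C f)\<^esub> f"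

locale additive_category = category C
  for C :: "('o, 'm, 'z) additive_category_scheme" (structure) +
  assumes Hom_group: "a \<in> Obj C \<Longrightarrow> b \<in> Obj C \<Longrightarrow> comm_group (HomG C a b)"
    and cmp_add_right: "f \<in> Hom C a b \<Longrightarrow> f' \<in> Hom C a b \<Longrightarrow> g \<in> Hom C b c \<Longrightarrow>
      g \<cdot> addm C f f' = addm C (g \<cdot> f) (g \<cdot> f')"
    and cmp_add_left: "f \<in> Hom C a b \<Longrightarrow> g \<in> Hom C b c \<Longrightarrow> g' \<in> Hom C b c \<Longrightarrow>
      addm C g g' \<cdot> f = addm C (g \<cdot> f) (g' \<cdot> f)"
    and zero_object: "\<exists>z. is_zero C z"
    and biproducts: "a \<in> Obj C \<Longrightarrow> b \<in> Obj C \<Longrightarrow>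
      \<exists>s p q k l. p \<in> Hom C s a \<and> q \<in> Hom C s b \<and> k \<in> Hom C a s \<and> l \<in> Hom C b s \<and>
        p \<cdot> k = idt C a \<and> q \<cdot> l = idt C b \<and> p \<cdot> l = zerom C b a \<and> q \<cdot> k = zerom C a b \<and>
        addm C (k \<cdot> p) (l \<cdot> q) = idt C s"

text \<open>The shifts \<open>M[n] = shO C n M\<close> form a strict action of the integers, as is customary; functors
  and the tensor product commute with them only up to specified isomorphisms. A member \<open>(f, g, h)\<close>
  of \<open>tri\<close> is a distinguished triangle \<open>a \<rightarrow> b \<rightarrow> c \<rightarrow> a[1]\<close>.\<close>

record ('o, 'm) triangulated_category = "('o, 'm) additive_category" +
  shO :: "int \<Rightarrow> 'o \<Rightarrow> 'o"
  shM :: "int \<Rightarrow> 'm \<Rightarrow> 'm"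
  tri :: "('m \<times> 'm \<times> 'm) set"

definition candidate_triangle ::
  "('o, 'm, 'z) triangulated_category_scheme \<Rightarrow> 'm \<Rightarrow> 'm \<Rightarrow> 'm \<Rightarrow> bool" where
  "candidate_triangle C f g h \<longleftrightarrow> f \<in> Arr C \<and> g \<in> Hom C (trg C f) (src C h) \<and>
     h \<in> Hom C (trg C g) (shO C 1 (src C f))"

locale triangulated_category = additive_category C
  for C :: "('o, 'm, 'z) triangulated_category_scheme" (structure) +
  assumes shO_Obj: "M \<in> Obj C \<Longrightarrow> shO C n M \<in> Obj C"
    and shM_Hom: "f \<in> Hom C a b \<Longrightarrow> shM C n f \<in> Hom C (shO C n a) (shO C n b)"
    and shM_idt: "M \<in> Obj C \<Longrightarrow> shM C n (idt C M) = idt C (shO C n M)"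
    and shM_cmp: "f \<in> Hom C a b \<Longrightarrow> g \<in> Hom C b c \<Longrightarrow> shM C n (g \<cdot> f) = shM C n g \<cdot> shM C n f"
    and shM_add: "f \<in> Hom C a b \<Longrightarrow> g \<in> Hom C a b \<Longrightarrow>
      shM C n (addm C f g) = addm C (shM C n f) (shM C n g)"
    and shO_0: "M \<in> Obj C \<Longrightarrow> shO C 0 M = M"
    and shM_0: "f \<in> Arr C \<Longrightarrow> shM C 0 f = f"
    and shO_plus: "M \<in> Obj C \<Longrightarrow> shO C (m + n) M = shO C n (shO C m M)"
    and shM_plus: "f \<in> Arr C \<Longrightarrow> shM C (m + n) f = shM C n (shM C m f)"
    and tri_candidate: "(f, g, h) \<in> tri C \<Longrightarrow> candidate_triangle C f g h"
    and TR1_cone: "f \<in> Arr C \<Longrightarrow> \<exists>g h. (f, g, h) \<in> tri C"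
    and TR1_idt: "M \<in> Obj C \<Longrightarrow> is_zero C z \<Longrightarrow>
      (idt C M, zerom C M z, zerom C z (shO C 1 M)) \<in> tri C"
    and TR1_iso: "(f, g, h) \<in> tri C \<Longrightarrow> candidate_triangle C f' g' h' \<Longrightarrow>
      u \<in> Hom C (src C f) (src C f') \<Longrightarrow> v \<in> Hom C (src C g) (src C g') \<Longrightarrow>
      w \<in> Hom C (src C h) (src C h') \<Longrightarrow> is_iso C u \<Longrightarrow> is_iso C v \<Longrightarrow> is_iso C w \<Longrightarrow>
      v \<cdot> f = f' \<cdot> u \<Longrightarrow> w \<cdot> g = g' \<cdot> v \<Longrightarrow> shM C 1 u \<cdot> h = h' \<cdot> w \<Longrightarrow>
      (f', g', h') \<in> tri C"
    and TR2: "candidate_triangle C f g h \<Longrightarrow>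
      (f, g, h) \<in> tri C \<longleftrightarrow> (g, h, negm C (shM C 1 f)) \<in> tri C"
    and TR3: "(f, g, h) \<in> tri C \<Longrightarrow> (f', g', h') \<in> tri C \<Longrightarrow>
      u \<in> Hom C (src C f) (src C f') \<Longrightarrow> v \<in> Hom C (src C g) (src C g') \<Longrightarrow> v \<cdot> f = f' \<cdot> u \<Longrightarrow>
      \<exists>w \<in> Hom C (src C h) (src C h'). w \<cdot> g = g' \<cdot> v \<and> shM C 1 u \<cdot> h = h' \<cdot> w"
    and TR4: "f \<in> Hom C a b \<Longrightarrow> g \<in> Hom C b c \<Longrightarrow> (f, u, u') \<in> tri C \<Longrightarrow> (g, v, v') \<in> tri C \<Longrightarrow>
      (g \<cdot> f, w, w') \<in> tri C \<Longrightarrow>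
      \<exists>p q. (p, q, shM C 1 u \<cdot> v') \<in> tri C \<and> p \<in> Hom C (trg C u) (trg C w) \<and>
        q \<in> Hom C (trg C w) (trg C v) \<and> p \<cdot> u = w \<cdot> g \<and> w' \<cdot> p = u' \<and> q \<cdot> w = v \<and>
        v' \<cdot> q = shM C 1 f \<cdot> w'"

section \<open>Triangulated symmetric monoidal categories\<close>

text \<open>\<open>tsh C a b n\<close> is the structure isomorphism \<open>a \<otimes> b[n] \<rightarrow> (a \<otimes> b)[n]\<close>.\<close>

record ('o, 'm) tensor_category = "('o, 'm) triangulated_category" +
  tenO :: "'o \<Rightarrow> 'o \<Rightarrow> 'o"
  tenM :: "'m \<Rightarrow> 'm \<Rightarrow> 'm"
  unt :: "'o"
  asc :: "'o \<Rightarrow> 'o \<Rightarrow> 'o \<Rightarrow> 'm"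
  lun :: "'o \<Rightarrow> 'm"
  run :: "'o \<Rightarrow> 'm"
  swp :: "'o \<Rightarrow> 'o \<Rightarrow> 'm"
  tsh :: "'o \<Rightarrow> 'o \<Rightarrow> int \<Rightarrow> 'm"

definition tshl :: "('o, 'm, 'z) tensor_category_scheme \<Rightarrow> 'o \<Rightarrow> 'o \<Rightarrow> int \<Rightarrow> 'm" where
  "tshl C a b n = shM C n (swp C b a) \<cdot>\<^bsub>C\<^esub> tsh C b a n \<cdot>\<^bsub>C\<^esub> swp C (shO C n a) b"

locale tensor_category = triangulated_category C
  for C :: "('o, 'm, 'z) tensor_category_scheme" (structure) +
  assumes tenO_Obj: "a \<in> Obj C \<Longrightarrow> b \<in> Obj C \<Longrightarrow> tenO C a b \<in> Obj C"
    and tenM_Hom: "f \<in> Hom C a a' \<Longrightarrow> g \<in> Hom C b b' \<Longrightarrow>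
      tenM C f g \<in> Hom C (tenO C a b) (tenO C a' b')"
    and tenM_idt: "a \<in> Obj C \<Longrightarrow> b \<in> Obj C \<Longrightarrow>
      tenM C (idt C a) (idt C b) = idt C (tenO C a b)"
    and tenM_cmp: "f \<in> Hom C a a' \<Longrightarrow> f' \<in> Hom C a' a'' \<Longrightarrow> g \<in> Hom C b b' \<Longrightarrow> g' \<in> Hom C b' b'' \<Longrightarrow>
      tenM C (f' \<cdot> f) (g' \<cdot> g) = tenM C f' g' \<cdot> tenM C f g"
    and tenM_add_left: "f \<in> Hom C a a' \<Longrightarrow> f' \<in> Hom C a a' \<Longrightarrow> g \<in> Hom C b b' \<Longrightarrow>
      tenM C (addm C f f') g = addm C (tenM C f g) (tenM C f' g)"
    and tenM_add_right: "f \<in> Hom C a a' \<Longrightarrow> g \<in> Hom C b b' \<Longrightarrow> g' \<in> Hom C b b' \<Longrightarrow>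
      tenM C f (addm C g g') = addm C (tenM C f g) (tenM C f g')"
    and unt_Obj: "unt C \<in> Obj C"
    and asc_Hom: "a \<in> Obj C \<Longrightarrow> b \<in> Obj C \<Longrightarrow> c \<in> Obj C \<Longrightarrow>
      asc C a b c \<in> Hom C (tenO C (tenO C a b) c) (tenO C a (tenO C b c))"
    and asc_iso: "a \<in> Obj C \<Longrightarrow> b \<in> Obj C \<Longrightarrow> c \<in> Obj C \<Longrightarrow> is_iso C (asc C a b c)"
    and asc_nat: "f \<in> Hom C a a' \<Longrightarrow> g \<in> Hom C b b' \<Longrightarrow> h \<in> Hom C c c' \<Longrightarrow>
      asc C a' b' c' \<cdot> tenM C (tenM C f g) h = tenM C f (tenM C g h) \<cdot> asc C a b c"
    and lun_Hom: "a \<in> Obj C \<Longrightarrow> lun C a \<in> Hom C (tenO C (unt C) a) a"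
    and lun_iso: "a \<in> Obj C \<Longrightarrow> is_iso C (lun C a)"
    and lun_nat: "f \<in> Hom C a b \<Longrightarrow> lun C b \<cdot> tenM C (idt C (unt C)) f = f \<cdot> lun C a"
    and run_Hom: "a \<in> Obj C \<Longrightarrow> run C a \<in> Hom C (tenO C a (unt C)) a"
    and run_iso: "a \<in> Obj C \<Longrightarrow> is_iso C (run C a)"
    and run_nat: "f \<in> Hom C a b \<Longrightarrow> run C b \<cdot> tenM C f (idt C (unt C)) = f \<cdot> run C a"
    and swp_Hom: "a \<in> Obj C \<Longrightarrow> b \<in> Obj C \<Longrightarrow> swp C a b \<in> Hom C (tenO C a b) (tenO C b a)"
    and swp_nat: "f \<in> Hom C a a' \<Longrightarrow> g \<in> Hom C b b' \<Longrightarrow>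
      swp C a' b' \<cdot> tenM C f g = tenM C g f \<cdot> swp C a b"
    and swp_swp: "a \<in> Obj C \<Longrightarrow> b \<in> Obj C \<Longrightarrow> swp C b a \<cdot> swp C a b = idt C (tenO C a b)"
    and pentagon: "a \<in> Obj C \<Longrightarrow> b \<in> Obj C \<Longrightarrow> c \<in> Obj C \<Longrightarrow> e \<in> Obj C \<Longrightarrow>
      asc C a b (tenO C c e) \<cdot> asc C (tenO C a b) c e =
        tenM C (idt C a) (asc C b c e) \<cdot> asc C a (tenO C b c) e \<cdot> tenM C (asc C a b c) (idt C e)"
    and triangle: "a \<in> Obj C \<Longrightarrow> b \<in> Obj C \<Longrightarrow>
      tenM C (idt C a) (lun C b) \<cdot> asc C a (unt C) b = tenM C (run C a) (idt C b)"
    and hexagon: "a \<in> Obj C \<Longrightarrow> b \<in> Obj C \<Longrightarrow> c \<in> Obj C \<Longrightarrow>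
      asc C b c a \<cdot> swp C a (tenO C b c) \<cdot> asc C a b c =
        tenM C (idt C b) (swp C a c) \<cdot> asc C b a c \<cdot> tenM C (swp C a b) (idt C c)"
    and tsh_Hom: "a \<in> Obj C \<Longrightarrow> b \<in> Obj C \<Longrightarrow>
      tsh C a b n \<in> Hom C (tenO C a (shO C n b)) (shO C n (tenO C a b))"
    and tsh_iso: "a \<in> Obj C \<Longrightarrow> b \<in> Obj C \<Longrightarrow> is_iso C (tsh C a b n)"
    and tsh_nat: "f \<in> Hom C a a' \<Longrightarrow> g \<in> Hom C b b' \<Longrightarrow>
      tsh C a' b' n \<cdot> tenM C f (shM C n g) = shM C n (tenM C f g) \<cdot> tsh C a b n"
    and tsh_0: "a \<in> Obj C \<Longrightarrow> b \<in> Obj C \<Longrightarrow> tsh C a b 0 = idt C (tenO C a b)"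
    and tsh_plus: "a \<in> Obj C \<Longrightarrow> b \<in> Obj C \<Longrightarrow>
      tsh C a b (m + n) = shM C n (tsh C a b m) \<cdot> tsh C a (shO C m b) n"
    and tsh_lun: "a \<in> Obj C \<Longrightarrow> shM C n (lun C a) \<cdot> tsh C (unt C) a n = lun C (shO C n a)"
    and tsh_asc: "a \<in> Obj C \<Longrightarrow> b \<in> Obj C \<Longrightarrow> c \<in> Obj C \<Longrightarrow>
      tsh C a (tenO C b c) n \<cdot> tenM C (idt C a) (tsh C b c n) \<cdot> asc C a b (shO C n c) =
        shM C n (asc C a b c) \<cdot> tsh C (tenO C a b) c n"
    and tsh_sign: "a \<in> Obj C \<Longrightarrow> b \<in> Obj C \<Longrightarrow>
      shM C 1 (tshl C a b 1) \<cdot> tsh C (shO C 1 a) b 1 =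
        negm C (shM C 1 (tsh C a b 1) \<cdot> tshl C a (shO C 1 b) 1)"
    and ten_exact: "a \<in> Obj C \<Longrightarrow> (f, g, h) \<in> tri C \<Longrightarrow>
      (tenM C (idt C a) f, tenM C (idt C a) g, tsh C a (src C f) 1 \<cdot> tenM C (idt C a) h) \<in> tri C"

section \<open>Exact functors, tensor functors, adjunctions\<close>

text \<open>\<open>shc F M n\<close> is the structure isomorphism \<open>F(M[n]) \<rightarrow> F(M)[n]\<close>.\<close>

record ('o, 'm) exact_functor =
  omap :: "'o \<Rightarrow> 'o"
  mmap :: "'m \<Rightarrow> 'm"
  shc :: "'o \<Rightarrow> int \<Rightarrow> 'm"

locale exact_functor = C: triangulated_category C + D: triangulated_category D
  for C :: "('o, 'm, 'y) triangulated_category_scheme"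
    and D :: "('o, 'm, 'z) triangulated_category_scheme" +
  fixes F :: "('o, 'm, 'w) exact_functor_scheme"
  assumes omap_Obj: "M \<in> Obj C \<Longrightarrow> omap F M \<in> Obj D"
    and mmap_Hom: "f \<in> Hom C a b \<Longrightarrow> mmap F f \<in> Hom D (omap F a) (omap F b)"
    and mmap_idt: "M \<in> Obj C \<Longrightarrow> mmap F (idt C M) = idt D (omap F M)"
    and mmap_cmp: "f \<in> Hom C a b \<Longrightarrow> g \<in> Hom C b c \<Longrightarrow>
      mmap F (g \<cdot>\<^bsub>C\<^esub> f) = mmap F g \<cdot>\<^bsub>D\<^esub> mmap F f"
    and mmap_add: "f \<in> Hom C a b \<Longrightarrow> g \<in> Hom C a b \<Longrightarrow>
      mmap F (addm C f g) = addm D (mmap F f) (mmap F g)"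
    and shc_Hom: "M \<in> Obj C \<Longrightarrow> shc F M n \<in> Hom D (omap F (shO C n M)) (shO D n (omap F M))"
    and shc_iso: "M \<in> Obj C \<Longrightarrow> is_iso D (shc F M n)"
    and shc_nat: "f \<in> Hom C a b \<Longrightarrow>
      shc F b n \<cdot>\<^bsub>D\<^esub> mmap F (shM C n f) = shM D n (mmap F f) \<cdot>\<^bsub>D\<^esub> shc F a n"
    and shc_0: "M \<in> Obj C \<Longrightarrow> shc F M 0 = idt D (omap F M)"
    and shc_plus: "M \<in> Obj C \<Longrightarrow>
      shc F M (m + n) = shM D n (shc F M m) \<cdot>\<^bsub>D\<^esub> shc F (shO C m M) n"
    and mmap_tri: "(f, g, h) \<in> tri C \<Longrightarrow>
      (mmap F f, mmap F g, shc F (src C f) 1 \<cdot>\<^bsub>D\<^esub> mmap F h) \<in> tri D"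

record ('o, 'm) tensor_functor = "('o, 'm) exact_functor" +
  mul :: "'o \<Rightarrow> 'o \<Rightarrow> 'm"
  one_cmp :: "'m"

locale tensor_functor = C: tensor_category C + D: tensor_category D + exact_functor C D F
  for C :: "('o, 'm, 'y) tensor_category_scheme"
    and D :: "('o, 'm, 'z) tensor_category_scheme"
    and F :: "('o, 'm, 'w) tensor_functor_scheme" +
  assumes mul_Hom: "a \<in> Obj C \<Longrightarrow> b \<in> Obj C \<Longrightarrow>
      mul F a b \<in> Hom D (tenO D (omap F a) (omap F b)) (omap F (tenO C a b))"
    and mul_iso: "a \<in> Obj C \<Longrightarrow> b \<in> Obj C \<Longrightarrow> is_iso D (mul F a b)"
    and mul_nat: "f \<in> Hom C a a' \<Longrightarrow> g \<in> Hom C b b' \<Longrightarrow>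
      mul F a' b' \<cdot>\<^bsub>D\<^esub> tenM D (mmap F f) (mmap F g) = mmap F (tenM C f g) \<cdot>\<^bsub>D\<^esub> mul F a b"
    and one_cmp_Hom: "one_cmp F \<in> Hom D (unt D) (omap F (unt C))"
    and one_cmp_iso: "is_iso D (one_cmp F)"
    and mul_asc: "a \<in> Obj C \<Longrightarrow> b \<in> Obj C \<Longrightarrow> c \<in> Obj C \<Longrightarrow>
      mmap F (asc C a b c) \<cdot>\<^bsub>D\<^esub> mul F (tenO C a b) c \<cdot>\<^bsub>D\<^esub> tenM D (mul F a b) (idt D (omap F c)) =
        mul F a (tenO C b c) \<cdot>\<^bsub>D\<^esub> tenM D (idt D (omap F a)) (mul F b c) \<cdot>\<^bsub>D\<^esub>
          asc D (omap F a) (omap F b) (omap F c)"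
    and mul_lun: "a \<in> Obj C \<Longrightarrow>
      mmap F (lun C a) \<cdot>\<^bsub>D\<^esub> mul F (unt C) a \<cdot>\<^bsub>D\<^esub> tenM D (one_cmp F) (idt D (omap F a)) =
        lun D (omap F a)"
    and mul_run: "a \<in> Obj C \<Longrightarrow>
      mmap F (run C a) \<cdot>\<^bsub>D\<^esub> mul F a (unt C) \<cdot>\<^bsub>D\<^esub> tenM D (idt D (omap F a)) (one_cmp F) =
        run D (omap F a)"
    and mul_swp: "a \<in> Obj C \<Longrightarrow> b \<in> Obj C \<Longrightarrow>
      mmap F (swp C a b) \<cdot>\<^bsub>D\<^esub> mul F a b = mul F b a \<cdot>\<^bsub>D\<^esub> swp D (omap F a) (omap F b)"
    and mul_tsh: "a \<in> Obj C \<Longrightarrow> b \<in> Obj C \<Longrightarrow>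
      shc F (tenO C a b) n \<cdot>\<^bsub>D\<^esub> mmap F (tsh C a b n) \<cdot>\<^bsub>D\<^esub> mul F a (shO C n b) =
        shM D n (mul F a b) \<cdot>\<^bsub>D\<^esub> tsh D (omap F a) (omap F b) n \<cdot>\<^bsub>D\<^esub>
          tenM D (idt D (omap F a)) (shc F b n)"

text \<open>An adjunction \<open>L \<stileturn> R\<close> of exact functors. The shift isomorphisms of an adjoint are determined by
  those of the other functor; \<open>eta_shift\<close> says that the given ones correspond in this way.\<close>

locale exact_adjunction = L: exact_functor C D L + R: exact_functor D C R
  for C :: "('o, 'm, 'y) triangulated_category_scheme"
    and D :: "('o, 'm, 'z) triangulated_category_scheme"
    and L :: "('o, 'm, 'v) exact_functor_scheme"
    and R :: "('o, 'm, 'w) exact_functor_scheme" +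
  fixes eta :: "'o \<Rightarrow> 'm" and eps :: "'o \<Rightarrow> 'm"
  assumes eta_Hom: "M \<in> Obj C \<Longrightarrow> eta M \<in> Hom C M (omap R (omap L M))"
    and eta_nat: "f \<in> Hom C a b \<Longrightarrow> eta b \<cdot>\<^bsub>C\<^esub> f = mmap R (mmap L f) \<cdot>\<^bsub>C\<^esub> eta a"
    and eps_Hom: "N \<in> Obj D \<Longrightarrow> eps N \<in> Hom D (omap L (omap R N)) N"
    and eps_nat: "f \<in> Hom D a b \<Longrightarrow> eps b \<cdot>\<^bsub>D\<^esub> mmap L (mmap R f) = f \<cdot>\<^bsub>D\<^esub> eps a"
    and eps_eta: "M \<in> Obj C \<Longrightarrow> eps (omap L M) \<cdot>\<^bsub>D\<^esub> mmap L (eta M) = idt D (omap L M)"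
    and eta_eps: "N \<in> Obj D \<Longrightarrow> mmap R (eps N) \<cdot>\<^bsub>C\<^esub> eta (omap R N) = idt C (omap R N)"
    and eta_shift: "M \<in> Obj C \<Longrightarrow>
      shc R (omap L M) n \<cdot>\<^bsub>C\<^esub> mmap R (shc L M n) \<cdot>\<^bsub>C\<^esub> eta (shO C n M) = shM C n (eta M)"

definition fully_faithful ::
  "('o, 'm, 'y) category_scheme \<Rightarrow> ('o, 'm, 'z) category_scheme \<Rightarrow>
   ('o, 'm, 'w) exact_functor_scheme \<Rightarrow> bool" where
  "fully_faithful C D F \<longleftrightarrow> (\<forall>a \<in> Obj C. \<forall>b \<in> Obj C.
     bij_betw (mmap F) (Hom C a b) (Hom D (omap F a) (omap F b)))"

section \<open>Spaces and their coefficient categories\<close>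

text \<open>Spaces are the objects of an abstract category \<open>spaces\<close>. For \<open>f : X \<rightarrow> Y\<close>, \<open>pull f\<close> is \<open>f\<^sup>*\<close> and
  \<open>push f\<close> is its right adjoint \<open>f\<^sub>*\<close>, with unit \<open>aunit f\<close> and counit \<open>acounit f\<close>;
  \<open>pcomp f g M\<close> is the isomorphism \<open>(g f)\<^sup>* M \<rightarrow> f\<^sup>* g\<^sup>* M\<close> and \<open>pid X M\<close> is
  \<open>(id\<^sub>X)\<^sup>* M \<rightarrow> M\<close>.\<close>

record ('s, 'f, 'o, 'm) coefficient_system =
  spaces :: "('s, 'f) category"
  cat :: "'s \<Rightarrow> ('o, 'm) tensor_category"
  pull :: "'f \<Rightarrow> ('o, 'm) tensor_functor"
  push :: "'f \<Rightarrow> ('o, 'm) exact_functor"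
  aunit :: "'f \<Rightarrow> 'o \<Rightarrow> 'm"
  acounit :: "'f \<Rightarrow> 'o \<Rightarrow> 'm"
  pcomp :: "'f \<Rightarrow> 'f \<Rightarrow> 'o \<Rightarrow> 'm"
  pid :: "'s \<Rightarrow> 'o \<Rightarrow> 'm"

abbreviation pullO :: "('s, 'f, 'o, 'm) coefficient_system \<Rightarrow> 'f \<Rightarrow> 'o \<Rightarrow> 'o" where
  "pullO S f A \<equiv> omap (pull S f) A"

abbreviation pushO :: "('s, 'f, 'o, 'm) coefficient_system \<Rightarrow> 'f \<Rightarrow> 'o \<Rightarrow> 'o" where
  "pushO S f A \<equiv> omap (push S f) A"

abbreviation dm :: "('s, 'f, 'o, 'm) coefficient_system \<Rightarrow> 'f \<Rightarrow> 's" where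
  "dm S f \<equiv> src (spaces S) f"

abbreviation cd :: "('s, 'f, 'o, 'm) coefficient_system \<Rightarrow> 'f \<Rightarrow> 's" where
  "cd S f \<equiv> trg (spaces S) f"

locale coefficient_system = spaces: category "spaces S"
  for S :: "('s, 'f, 'o, 'm) coefficient_system" (structure) +
  assumes cat: "X \<in> Obj (spaces S) \<Longrightarrow> tensor_category (cat S X)"
    and pull: "f \<in> Arr (spaces S) \<Longrightarrow> tensor_functor (cat S (cd S f)) (cat S (dm S f)) (pull S f)"
    and adj: "f \<in> Arr (spaces S) \<Longrightarrow>
      exact_adjunction (cat S (cd S f)) (cat S (dm S f)) (pull S f) (push S f)
        (aunit S f) (acounit S f)"
    and pcomp_Hom: "f \<in> Hom (spaces S) X Y \<Longrightarrow> g \<in> Hom (spaces S) Y W \<Longrightarrow> M \<in> Obj (cat S W) \<Longrightarrow>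
      pcomp S f g M \<in> Hom (cat S X) (pullO S (g \<cdot>\<^bsub>spaces S\<^esub> f) M) (pullO S f (pullO S g M))"
    and pcomp_iso: "f \<in> Hom (spaces S) X Y \<Longrightarrow> g \<in> Hom (spaces S) Y W \<Longrightarrow> M \<in> Obj (cat S W) \<Longrightarrow>
      is_iso (cat S X) (pcomp S f g M)"
    and pcomp_nat: "f \<in> Hom (spaces S) X Y \<Longrightarrow> g \<in> Hom (spaces S) Y W \<Longrightarrow>
      h \<in> Hom (cat S W) M N \<Longrightarrow>
      pcomp S f g N \<cdot>\<^bsub>cat S X\<^esub> mmap (pull S (g \<cdot>\<^bsub>spaces S\<^esub> f)) h =
        mmap (pull S f) (mmap (pull S g) h) \<cdot>\<^bsub>cat S X\<^esub> pcomp S f g M"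
    and pcomp_shift: "f \<in> Hom (spaces S) X Y \<Longrightarrow> g \<in> Hom (spaces S) Y W \<Longrightarrow>
      M \<in> Obj (cat S W) \<Longrightarrow>
      shM (cat S X) n (pcomp S f g M) \<cdot>\<^bsub>cat S X\<^esub> shc (pull S (g \<cdot>\<^bsub>spaces S\<^esub> f)) M n =
        shc (pull S f) (pullO S g M) n \<cdot>\<^bsub>cat S X\<^esub> mmap (pull S f) (shc (pull S g) M n) \<cdot>\<^bsub>cat S X\<^esub>
          pcomp S f g (shO (cat S W) n M)"
    and pcomp_mul: "f \<in> Hom (spaces S) X Y \<Longrightarrow> g \<in> Hom (spaces S) Y W \<Longrightarrow>
      M \<in> Obj (cat S W) \<Longrightarrow> N \<in> Obj (cat S W) \<Longrightarrow>
      pcomp S f g (tenO (cat S W) M N) \<cdot>\<^bsub>cat S X\<^esub> mul (pull S (g \<cdot>\<^bsub>spaces S\<^esub> f)) M N =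
        mmap (pull S f) (mul (pull S g) M N) \<cdot>\<^bsub>cat S X\<^esub>
          mul (pull S f) (pullO S g M) (pullO S g N) \<cdot>\<^bsub>cat S X\<^esub>
          tenM (cat S X) (pcomp S f g M) (pcomp S f g N)"
    and pcomp_one: "f \<in> Hom (spaces S) X Y \<Longrightarrow> g \<in> Hom (spaces S) Y W \<Longrightarrow>
      pcomp S f g (unt (cat S W)) \<cdot>\<^bsub>cat S X\<^esub> one_cmp (pull S (g \<cdot>\<^bsub>spaces S\<^esub> f)) =
        mmap (pull S f) (one_cmp (pull S g)) \<cdot>\<^bsub>cat S X\<^esub> one_cmp (pull S f)"
    and pcomp_assoc: "f \<in> Hom (spaces S) X Y \<Longrightarrow> g \<in> Hom (spaces S) Y W \<Longrightarrow>
      k \<in> Hom (spaces S) W V \<Longrightarrow> M \<in> Obj (cat S V) \<Longrightarrow>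
      mmap (pull S f) (pcomp S g k M) \<cdot>\<^bsub>cat S X\<^esub> pcomp S f (k \<cdot>\<^bsub>spaces S\<^esub> g) M =
        pcomp S f g (pullO S k M) \<cdot>\<^bsub>cat S X\<^esub> pcomp S (g \<cdot>\<^bsub>spaces S\<^esub> f) k M"
    and pid_Hom: "X \<in> Obj (spaces S) \<Longrightarrow> M \<in> Obj (cat S X) \<Longrightarrow>
      pid S X M \<in> Hom (cat S X) (pullO S (idt (spaces S) X) M) M"
    and pid_iso: "X \<in> Obj (spaces S) \<Longrightarrow> M \<in> Obj (cat S X) \<Longrightarrow> is_iso (cat S X) (pid S X M)"
    and pid_nat: "X \<in> Obj (spaces S) \<Longrightarrow> h \<in> Hom (cat S X) M N \<Longrightarrow>
      pid S X N \<cdot>\<^bsub>cat S X\<^esub> mmap (pull S (idt (spaces S) X)) h = h \<cdot>\<^bsub>cat S X\<^esub> pid S X M"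
    and pid_shift: "X \<in> Obj (spaces S) \<Longrightarrow> M \<in> Obj (cat S X) \<Longrightarrow>
      shM (cat S X) n (pid S X M) \<cdot>\<^bsub>cat S X\<^esub> shc (pull S (idt (spaces S) X)) M n =
        pid S X (shO (cat S X) n M)"
    and pid_mul: "X \<in> Obj (spaces S) \<Longrightarrow> M \<in> Obj (cat S X) \<Longrightarrow> N \<in> Obj (cat S X) \<Longrightarrow>
      pid S X (tenO (cat S X) M N) \<cdot>\<^bsub>cat S X\<^esub> mul (pull S (idt (spaces S) X)) M N =
        tenM (cat S X) (pid S X M) (pid S X N)"
    and pid_one: "X \<in> Obj (spaces S) \<Longrightarrow>
      pid S X (unt (cat S X)) \<cdot>\<^bsub>cat S X\<^esub> one_cmp (pull S (idt (spaces S) X)) =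
        idt (cat S X) (unt (cat S X))"
    and pcomp_id_left: "f \<in> Hom (spaces S) X Y \<Longrightarrow> M \<in> Obj (cat S Y) \<Longrightarrow>
      pid S X (pullO S f M) \<cdot>\<^bsub>cat S X\<^esub> pcomp S (idt (spaces S) X) f M =
        idt (cat S X) (pullO S f M)"
    and pcomp_id_right: "f \<in> Hom (spaces S) X Y \<Longrightarrow> M \<in> Obj (cat S Y) \<Longrightarrow>
      mmap (pull S f) (pid S Y M) \<cdot>\<^bsub>cat S X\<^esub> pcomp S f (idt (spaces S) Y) M =
        idt (cat S X) (pullO S f M)"

section \<open>Recollement for a closed immersion with open complement\<close>

text \<open>\<open>upperS\<close> is \<open>i\<^sup>!\<close> and \<open>lowerS\<close> is \<open>j\<^sub>!\<close>; \<open>ieta\<close>, \<open>ieps\<close> are unit and counit of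
  \<open>i\<^sub>* \<stileturn> i\<^sup>!\<close>, and \<open>jeta\<close>, \<open>jeps\<close> those of \<open>j\<^sub>! \<stileturn> j\<^sup>*\<close>. The boundary maps are
  \<open>bdry M : j\<^sub>* j\<^sup>* M \<rightarrow> (i\<^sub>* i\<^sup>! M)[1]\<close> and \<open>cobdry M : i\<^sub>* i\<^sup>* M \<rightarrow> (j\<^sub>! j\<^sup>* M)[1]\<close>.\<close>

record ('o, 'm) recollement =
  upperS :: "('o, 'm) exact_functor"
  lowerS :: "('o, 'm) exact_functor"
  ieta :: "'o \<Rightarrow> 'm"
  ieps :: "'o \<Rightarrow> 'm"
  jeta :: "'o \<Rightarrow> 'm"
  jeps :: "'o \<Rightarrow> 'm"
  bdry :: "'o \<Rightarrow> 'm"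
  cobdry :: "'o \<Rightarrow> 'm"

locale recollement =
  fixes S :: "('s, 'f, 'o, 'm) coefficient_system" and i j :: 'f
    and R :: "('o, 'm) recollement"
  assumes i_Arr: "i \<in> Arr (spaces S)"
    and j_Arr: "j \<in> Arr (spaces S)"
    and same_target: "cd S j = cd S i"
    and adj_i: "exact_adjunction (cat S (dm S i)) (cat S (cd S i)) (push S i) (upperS R)
      (ieta R) (ieps R)"
    and adj_j: "exact_adjunction (cat S (dm S j)) (cat S (cd S i)) (lowerS R) (pull S j)
      (jeta R) (jeps R)"
    and ff_i: "fully_faithful (cat S (dm S i)) (cat S (cd S i)) (push S i)"
    and ff_j: "fully_faithful (cat S (dm S j)) (cat S (cd S i)) (lowerS R)"
    and j_i_zero: "M \<in> Obj (cat S (dm S i)) \<Longrightarrow> is_zero (cat S (dm S j)) (pullO S j (pushO S i M))"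
    and i_j_zero: "M \<in> Obj (cat S (dm S j)) \<Longrightarrow>
      is_zero (cat S (dm S i)) (pullO S i (omap (lowerS R) M))"
    and open_closed: "M \<in> Obj (cat S (cd S i)) \<Longrightarrow>
      (jeps R M, aunit S i M, cobdry R M) \<in> tri (cat S (cd S i))"
    and closed_open: "M \<in> Obj (cat S (cd S i)) \<Longrightarrow>
      (ieps R M, aunit S j M, bdry R M) \<in> tri (cat S (cd S i))"
    and cobdry_nat: "f \<in> Hom (cat S (cd S i)) M N \<Longrightarrow>
      cobdry R N \<cdot>\<^bsub>cat S (cd S i)\<^esub> mmap (push S i) (mmap (pull S i) f) =
        shM (cat S (cd S i)) 1 (mmap (lowerS R) (mmap (pull S j) f)) \<cdot>\<^bsub>cat S (cd S i)\<^esub> cobdry R M"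
    and bdry_nat: "f \<in> Hom (cat S (cd S i)) M N \<Longrightarrow>
      bdry R N \<cdot>\<^bsub>cat S (cd S i)\<^esub> mmap (push S j) (mmap (pull S j) f) =
        shM (cat S (cd S i)) 1 (mmap (push S i) (mmap (upperS R) f)) \<cdot>\<^bsub>cat S (cd S i)\<^esub> bdry R M"

section \<open>Cohomology, supports and localisation\<close>

definition coh :: "('s, 'f, 'o, 'm) coefficient_system \<Rightarrow> 's \<Rightarrow> 'o \<Rightarrow> int \<Rightarrow> 'm monoid" where
  "coh S X A n = HomG (cat S X) (unt (cat S X)) (shO (cat S X) n A)"

definition supp :: "('s, 'f, 'o, 'm) coefficient_system \<Rightarrow> 'f \<Rightarrow> ('o, 'm) recollement \<Rightarrow> 'o \<Rightarrow> 'o" where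
  "supp S i R A = pushO S i (omap (upperS R) A)"

definition supp_coh :: "('s, 'f, 'o, 'm) coefficient_system \<Rightarrow> 'f \<Rightarrow> ('o, 'm) recollement \<Rightarrow>
    'o \<Rightarrow> int \<Rightarrow> 'm monoid" where
  "supp_coh S i R A n = coh S (cd S i) (supp S i R A) n"

definition coef :: "('s, 'f, 'o, 'm) coefficient_system \<Rightarrow> 's \<Rightarrow> 'm \<Rightarrow> int \<Rightarrow> 'm \<Rightarrow> 'm" where
  "coef S X \<phi> n a = shM (cat S X) n \<phi> \<cdot>\<^bsub>cat S X\<^esub> a"

text \<open>The restriction \<open>f\<^sup>* : H\<^sup>n(Y; A) \<rightarrow> H\<^sup>n(X; f\<^sup>* A)\<close> along \<open>f : X \<rightarrow> Y\<close>.\<close>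

definition restr :: "('s, 'f, 'o, 'm) coefficient_system \<Rightarrow> 'f \<Rightarrow> 'o \<Rightarrow> int \<Rightarrow> 'm \<Rightarrow> 'm" where
  "restr S f A n a = shc (pull S f) A n \<cdot>\<^bsub>cat S (dm S f)\<^esub> mmap (pull S f) a
     \<cdot>\<^bsub>cat S (dm S f)\<^esub> one_cmp (pull S f)"

definition forg :: "('s, 'f, 'o, 'm) coefficient_system \<Rightarrow> 'f \<Rightarrow> ('o, 'm) recollement \<Rightarrow>
    'o \<Rightarrow> int \<Rightarrow> 'm \<Rightarrow> 'm" where
  "forg S i R A n = coef S (cd S i) (ieps R A) n"

text \<open>For \<open>f : Y \<rightarrow> X\<close> the adjunction identifies \<open>H\<^sup>n(Y; B)\<close> with \<open>H\<^sup>n(X; f\<^sub>* B)\<close>: it sends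
  \<open>z : 1 \<rightarrow> B[n]\<close> on \<open>Y\<close> to
  \<open>1 \<rightarrow> f\<^sub>* f\<^sup>* 1 \<cong> f\<^sub>* 1 \<rightarrow> f\<^sub>*(B[n]) \<cong> (f\<^sub>* B)[n]\<close>.\<close>

definition transpose_up :: "('s, 'f, 'o, 'm) coefficient_system \<Rightarrow> 'f \<Rightarrow> 'o \<Rightarrow> int \<Rightarrow> 'm \<Rightarrow> 'm" where
  "transpose_up S f B n z =
     shc (push S f) B n \<cdot>\<^bsub>cat S (cd S f)\<^esub> mmap (push S f) z \<cdot>\<^bsub>cat S (cd S f)\<^esub>
     mmap (push S f) (inv_arr (cat S (dm S f)) (one_cmp (pull S f))) \<cdot>\<^bsub>cat S (cd S f)\<^esub>
     aunit S f (unt (cat S (cd S f)))"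

text \<open>The inverse transposition sends \<open>a : 1 \<rightarrow> (f\<^sub>* B)[n]\<close> on \<open>X\<close> to
  \<open>1 \<cong> f\<^sup>* 1 \<rightarrow> f\<^sup>*((f\<^sub>* B)[n]) \<cong> (f\<^sup>* f\<^sub>* B)[n] \<rightarrow> B[n]\<close>.\<close>

definition transpose_down :: "('s, 'f, 'o, 'm) coefficient_system \<Rightarrow> 'f \<Rightarrow> 'o \<Rightarrow> int \<Rightarrow> 'm \<Rightarrow> 'm" where
  "transpose_down S f B n a = coef S (dm S f) (acounit S f B) n (restr S f (pushO S f B) n a)"

text \<open>The connecting map \<open>H\<^sup>n(U; j\<^sup>* A) \<rightarrow> H\<^sup>n\<^sup>+\<^sup>1\<^sub>Z(X; A)\<close>.\<close>

definition delta :: "('s, 'f, 'o, 'm) coefficient_system \<Rightarrow> 'f \<Rightarrow> ('o, 'm) recollement \<Rightarrow>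
    'o \<Rightarrow> int \<Rightarrow> 'm \<Rightarrow> 'm" where
  "delta S j R A n z = coef S (cd S j) (bdry R A) n (transpose_up S j (pullO S j A) n z)"

definition secondary_group :: "('s, 'f, 'o, 'm) coefficient_system \<Rightarrow> 'f \<Rightarrow> ('o, 'm) recollement \<Rightarrow>
    'o \<Rightarrow> int \<Rightarrow> 'm set" where
  "secondary_group S j R A d =
     delta S j R A (d - 1) ` carrier (coh S (dm S j) (pullO S j A) (d - 1))"

definition supported_lifts :: "('s, 'f, 'o, 'm) coefficient_system \<Rightarrow> 'f \<Rightarrow> ('o, 'm) recollement \<Rightarrow>
    'o \<Rightarrow> int \<Rightarrow> 'm \<Rightarrow> 'm set" where
  "supported_lifts S i R A d c = {x \<in> carrier (supp_coh S i R A d). forg S i R A d x = c}"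

text \<open>\<open>H\<^sup>d\<^sub>Z(X; A) \<cong> Hom(1\<^sub>Z, (i\<^sup>! A)[d])\<close>.\<close>

definition supp_adj :: "('s, 'f, 'o, 'm) coefficient_system \<Rightarrow> 'f \<Rightarrow> ('o, 'm) recollement \<Rightarrow>
    'o \<Rightarrow> int \<Rightarrow> 'm \<Rightarrow> 'm" where
  "supp_adj S i R A d = transpose_down S i (omap (upperS R) A) d"

definition localisation_torsor :: "('s, 'f, 'o, 'm) coefficient_system \<Rightarrow> 'f \<Rightarrow>
    ('o, 'm) recollement \<Rightarrow> 'o \<Rightarrow> int \<Rightarrow> 'm \<Rightarrow> 'm set" where
  "localisation_torsor S i R A d c = supp_adj S i R A d ` supported_lifts S i R A d c"

text \<open>Meaningful only when the localisation torsor is a singleton.\<close>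

definition localised_class :: "('s, 'f, 'o, 'm) coefficient_system \<Rightarrow> 'f \<Rightarrow>
    ('o, 'm) recollement \<Rightarrow> 'o \<Rightarrow> int \<Rightarrow> 'm \<Rightarrow> 'm" where
  "localised_class S i R A d c = the_elem (localisation_torsor S i R A d c)"

text \<open>The product \<open>H\<^sup>p(X; A) \<times> H\<^sup>q(X; B) \<rightarrow> H\<^sup>p\<^sup>+\<^sup>q(X; A \<otimes> B)\<close>, and its special case \<open>B = 1\<close> with
  \<open>A \<otimes> 1\<close> replaced by \<open>A\<close>.\<close>

definition cup :: "('s, 'f, 'o, 'm) coefficient_system \<Rightarrow> 's \<Rightarrow> 'o \<Rightarrow> int \<Rightarrow> 'o \<Rightarrow> int \<Rightarrow>
    'm \<Rightarrow> 'm \<Rightarrow> 'm" where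
  "cup S X A p B q a b = (let C = cat S X in
     shM C q (tshl C A B p) \<cdot>\<^bsub>C\<^esub> tsh C (shO C p A) B q \<cdot>\<^bsub>C\<^esub> tenM C a b \<cdot>\<^bsub>C\<^esub>
     inv_arr C (lun C (unt C)))"

definition cup1 :: "('s, 'f, 'o, 'm) coefficient_system \<Rightarrow> 's \<Rightarrow> 'o \<Rightarrow> int \<Rightarrow> int \<Rightarrow>
    'm \<Rightarrow> 'm \<Rightarrow> 'm" where
  "cup1 S X A p q a b = coef S X (run (cat S X) A) (p + q) (cup S X A p (unt (cat S X)) q a b)"

section \<open>The oriented normal object and its disk and sphere bundles\<close>

text \<open>For \<open>i : Z \<rightarrow> X\<close> and \<open>j : U \<rightarrow> X\<close>:
  \<open>nproj : N \<rightarrow> Z\<close>, \<open>dincl : D(N) \<rightarrow> N\<close>, \<open>dproj : D(N) \<rightarrow> Z\<close>, zero section \<open>zsec : Z \<rightarrow> D(N)\<close>,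
  \<open>punc : D(N) - Z \<rightarrow> D(N)\<close>, \<open>sincl : S(N) \<rightarrow> D(N) - Z\<close>, \<open>sretr : D(N) - Z \<rightarrow> S(N)\<close>,
  \<open>\<pi> = sproj : S(N) \<rightarrow> Z\<close>, and the tubular neighbourhood
  maps \<open>tube : D(N) \<rightarrow> X\<close>, \<open>tube0 : D(N) - Z \<rightarrow> U\<close>.\<close>

record 'f normal_data =
  nproj :: 'f
  dincl :: 'f
  dproj :: 'f
  zsec :: 'f
  punc :: 'f
  sincl :: 'f
  sretr :: 'f
  sproj :: 'f
  tube :: 'f
  tube0 :: 'f

locale tubular_neighbourhood =
  fixes S :: "('s, 'f, 'o, 'm) coefficient_system" and i j :: 'f and T :: "'f normal_data"
  assumes nproj_Hom: "nproj T \<in> Hom (spaces S) (cd S (dincl T)) (dm S i)"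
    and dincl_Hom: "dincl T \<in> Hom (spaces S) (dm S (tube T)) (dm S (nproj T))"
    and dproj_Hom: "dproj T \<in> Hom (spaces S) (dm S (tube T)) (dm S i)"
    and zsec_Hom: "zsec T \<in> Hom (spaces S) (dm S i) (dm S (tube T))"
    and punc_Hom: "punc T \<in> Hom (spaces S) (dm S (tube0 T)) (dm S (tube T))"
    and sincl_Hom: "sincl T \<in> Hom (spaces S) (dm S (sproj T)) (dm S (tube0 T))"
    and sretr_Hom: "sretr T \<in> Hom (spaces S) (dm S (tube0 T)) (dm S (sproj T))"
    and sproj_Hom: "sproj T \<in> Hom (spaces S) (dm S (sproj T)) (dm S i)"
    and tube_Hom: "tube T \<in> Hom (spaces S) (dm S (tube T)) (cd S i)"
    and tube0_Hom: "tube0 T \<in> Hom (spaces S) (dm S (tube0 T)) (dm S j)"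
    and disk_in_normal: "nproj T \<cdot>\<^bsub>spaces S\<^esub> dincl T = dproj T"
    and zero_section: "dproj T \<cdot>\<^bsub>spaces S\<^esub> zsec T = idt (spaces S) (dm S i)"
    and tube_zsec: "tube T \<cdot>\<^bsub>spaces S\<^esub> zsec T = i"
    and tube_punc: "tube T \<cdot>\<^bsub>spaces S\<^esub> punc T = j \<cdot>\<^bsub>spaces S\<^esub> tube0 T"
    and sphere_proj: "dproj T \<cdot>\<^bsub>spaces S\<^esub> punc T \<cdot>\<^bsub>spaces S\<^esub> sincl T = sproj T"
    and retraction: "sretr T \<cdot>\<^bsub>spaces S\<^esub> sincl T = idt (spaces S) (dm S (sproj T))"
    and retraction_over_Z: "sproj T \<cdot>\<^bsub>spaces S\<^esub> sretr T = dproj T \<cdot>\<^bsub>spaces S\<^esub> punc T"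

text \<open>An orientation of \<open>N\<close> (of real rank \<open>2r\<close>) is a Thom class \<open>u \<in> H\<^sup>2\<^sup>r\<^sub>Z(D(N); 1)\<close>: writing \<open>s\<close> for
  the zero section, its adjoint \<open>1\<^sub>Z \<rightarrow> (s\<^sup>! 1)[2r]\<close> is an isomorphism. The Euler class is
  the restriction of \<open>u\<close> along the zero section. \<open>Rn\<close> is the recollement for
  \<open>Z \<rightarrow> D(N) \<leftarrow> D(N) - Z\<close>.\<close>

definition orientation :: "('s, 'f, 'o, 'm) coefficient_system \<Rightarrow> 'f normal_data \<Rightarrow>
    ('o, 'm) recollement \<Rightarrow> nat \<Rightarrow> 'm \<Rightarrow> bool" where
  "orientation S T Rn r u \<longleftrightarrow>
     u \<in> carrier (supp_coh S (zsec T) Rn (unt (cat S (cd S (zsec T)))) (2 * int r)) \<and>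
     is_iso (cat S (dm S (zsec T)))
       (supp_adj S (zsec T) Rn (unt (cat S (cd S (zsec T)))) (2 * int r) u)"

definition euler_class :: "('s, 'f, 'o, 'm) coefficient_system \<Rightarrow> 'f normal_data \<Rightarrow>
    ('o, 'm) recollement \<Rightarrow> nat \<Rightarrow> 'm \<Rightarrow> 'm" where
  "euler_class S T Rn r u =
     coef S (dm S (zsec T)) (inv_arr (cat S (dm S (zsec T))) (one_cmp (pull S (zsec T)))) (2 * int r)
       (restr S (zsec T) (unt (cat S (cd S (zsec T)))) (2 * int r)
         (forg S (zsec T) Rn (unt (cat S (cd S (zsec T)))) (2 * int r) u))"

text \<open>\<open>euler_mult S i A r e k\<close> is \<open>\<union> e : H\<^sup>k\<^sup>-\<^sup>2\<^sup>r(Z; i\<^sup>* A) \<rightarrow> H\<^sup>k(Z; i\<^sup>* A)\<close>.\<close>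

definition euler_mult :: "('s, 'f, 'o, 'm) coefficient_system \<Rightarrow> 'f \<Rightarrow> 'o \<Rightarrow> nat \<Rightarrow> 'm \<Rightarrow> int \<Rightarrow>
    'm \<Rightarrow> 'm" where
  "euler_mult S i A r e k b = cup1 S (dm S i) (pullO S i A) (k - 2 * int r) (2 * int r) b e"

definition euler_quotient :: "('s, 'f, 'o, 'm) coefficient_system \<Rightarrow> 'f \<Rightarrow> 'o \<Rightarrow> nat \<Rightarrow> 'm \<Rightarrow>
    int \<Rightarrow> 'm \<Rightarrow> 'm" where
  "euler_quotient S i A r e k b =
     (THE \<gamma>. \<gamma> \<in> carrier (coh S (dm S i) (pullO S i A) (k - 2 * int r)) \<and>
        euler_mult S i A r e k \<gamma> = b)"

section \<open>The standing hypotheses\<close>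

text \<open>The canonical map \<open>t\<^sup>* i\<^sub>* i\<^sup>! A \<rightarrow> s\<^sub>* s\<^sup>! t\<^sup>* A\<close> for the tubular neighbourhood map \<open>t\<close>: the
  unique factorisation of \<open>t\<^sup>*\<close> of the counit \<open>i\<^sub>* i\<^sup>! A \<rightarrow> A\<close> through the counit of \<open>s\<^sub>* \<stileturn> s\<^sup>!\<close>. It
  exists and is unique because \<open>t\<^sup>* i\<^sub>*\<close> vanishes on \<open>D(N) - Z\<close>.\<close>

definition exc_map :: "('s, 'f, 'o, 'm) coefficient_system \<Rightarrow> 'f \<Rightarrow> ('o, 'm) recollement \<Rightarrow>
    'f normal_data \<Rightarrow> ('o, 'm) recollement \<Rightarrow> 'o \<Rightarrow> 'm" where
  "exc_map S i R T Rn A =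
     (THE \<kappa>. \<kappa> \<in> Hom (cat S (dm S (tube T)))
          (pullO S (tube T) (supp S i R A)) (supp S (zsec T) Rn (pullO S (tube T) A)) \<and>
        ieps Rn (pullO S (tube T) A) \<cdot>\<^bsub>cat S (dm S (tube T))\<^esub> \<kappa> = mmap (pull S (tube T)) (ieps R A))"

definition exc :: "('s, 'f, 'o, 'm) coefficient_system \<Rightarrow> 'f \<Rightarrow> ('o, 'm) recollement \<Rightarrow>
    'f normal_data \<Rightarrow> ('o, 'm) recollement \<Rightarrow> 'o \<Rightarrow> int \<Rightarrow> 'm \<Rightarrow> 'm" where
  "exc S i R T Rn A n x =
     coef S (dm S (tube T)) (exc_map S i R T Rn A) n (restr S (tube T) (supp S i R A) n x)"

text \<open>\<open>H\<^sup>n(D(N); t\<^sup>* A) \<rightarrow> H\<^sup>n(Z; i\<^sup>* A)\<close>, restriction along the zero section with \<open>s\<^sup>* t\<^sup>* \<cong> i\<^sup>*\<close>.\<close>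

definition zsec_restr :: "('s, 'f, 'o, 'm) coefficient_system \<Rightarrow> 'f normal_data \<Rightarrow> 'o \<Rightarrow> int \<Rightarrow>
    'm \<Rightarrow> 'm" where
  "zsec_restr S T A n y =
     coef S (dm S (zsec T)) (inv_arr (cat S (dm S (zsec T))) (pcomp S (zsec T) (tube T) A)) n
       (restr S (zsec T) (pullO S (tube T) A) n y)"

text \<open>The coefficients \<open>t\<^sup>* A\<close> on \<open>D(N) - Z\<close>.\<close>

abbreviation puncO :: "('s, 'f, 'o, 'm) coefficient_system \<Rightarrow> 'f normal_data \<Rightarrow> 'o \<Rightarrow> 'o" where
  "puncO S T A \<equiv> pullO S (punc T) (pullO S (tube T) A)"

text \<open>The two maps \<open>S(N) \<rightarrow> X\<close>, through \<open>D(N) - Z\<close> and through \<open>Z\<close>, are not equal, only homotopic, so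
  an isomorphism \<open>\<phi>\<close> from the restriction of \<open>t\<^sup>* A\<close> to \<open>\<pi>\<^sup>* i\<^sup>* A\<close> has to be specified.\<close>

definition sphere_coefficients :: "('s, 'f, 'o, 'm) coefficient_system \<Rightarrow> 'f \<Rightarrow> 'f normal_data \<Rightarrow>
    'o \<Rightarrow> 'm \<Rightarrow> bool" where
  "sphere_coefficients S i T A \<phi> \<longleftrightarrow>
     \<phi> \<in> Hom (cat S (dm S (sproj T)))
       (pullO S (sincl T) (puncO S T A)) (pullO S (sproj T) (pullO S i A)) \<and>
     is_iso (cat S (dm S (sproj T))) \<phi>"

definition sphere_restr :: "('s, 'f, 'o, 'm) coefficient_system \<Rightarrow> 'f normal_data \<Rightarrow> 'o \<Rightarrow> 'm \<Rightarrow>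
    int \<Rightarrow> 'm \<Rightarrow> 'm" where
  "sphere_restr S T A \<phi> n z =
     coef S (dm S (sproj T)) \<phi> n (restr S (sincl T) (puncO S T A) n z)"

definition excision :: "('s, 'f, 'o, 'm) coefficient_system \<Rightarrow> 'f \<Rightarrow> ('o, 'm) recollement \<Rightarrow>
    'f normal_data \<Rightarrow> ('o, 'm) recollement \<Rightarrow> 'o \<Rightarrow> 'm \<Rightarrow> bool" where
  "excision S i R T Rn A \<phi> \<longleftrightarrow>
     (\<forall>k. exc S i R T Rn A k \<in>
        iso (supp_coh S i R A k) (supp_coh S (zsec T) Rn (pullO S (tube T) A) k)) \<and>
     (\<forall>k. zsec_restr S T A k \<in>
        iso (coh S (dm S (tube T)) (pullO S (tube T) A) k) (coh S (dm S i) (pullO S i A) k)) \<and>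
     sphere_coefficients S i T A \<phi> \<and>
     (\<forall>k. sphere_restr S T A \<phi> k \<in>
        iso (coh S (dm S (punc T)) (puncO S T A) k)
          (coh S (dm S (sproj T)) (pullO S (sproj T) (pullO S i A)) k))"

text \<open>\<open>Th k : H\<^sup>k\<^sup>-\<^sup>2\<^sup>r(Z; i\<^sup>* A) \<rightarrow> H\<^sup>k\<^sub>Z(X; A)\<close>.\<close>

definition thom_isomorphism :: "('s, 'f, 'o, 'm) coefficient_system \<Rightarrow> 'f \<Rightarrow> ('o, 'm) recollement \<Rightarrow>
    'o \<Rightarrow> nat \<Rightarrow> 'm \<Rightarrow> (int \<Rightarrow> 'm \<Rightarrow> 'm) \<Rightarrow> bool" where
  "thom_isomorphism S i R A r e Th \<longleftrightarrow>
     (\<forall>k. Th k \<in> iso (coh S (dm S i) (pullO S i A) (k - 2 * int r)) (supp_coh S i R A k) \<and>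
       (\<forall>\<beta> \<in> carrier (coh S (dm S i) (pullO S i A) (k - 2 * int r)).
          restr S i A k (forg S i R A k (Th k \<beta>)) = euler_mult S i A r e k \<beta>))"

text \<open>\<open>G k\<close> is \<open>\<pi>\<^sub>* : H\<^sup>k\<^sup>-\<^sup>1(S(N); \<pi>\<^sup>* i\<^sup>* A) \<rightarrow> H\<^sup>k\<^sup>-\<^sup>2\<^sup>r(Z; i\<^sup>* A)\<close>.\<close>

definition gysin_sequence :: "('s, 'f, 'o, 'm) coefficient_system \<Rightarrow> 'f \<Rightarrow> 'f normal_data \<Rightarrow> 'o \<Rightarrow>
    nat \<Rightarrow> 'm \<Rightarrow> (int \<Rightarrow> 'm \<Rightarrow> 'm) \<Rightarrow> bool" where
  "gysin_sequence S i T A r e G \<longleftrightarrow>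
     (let HZ = coh S (dm S i) (pullO S i A);
          HS = coh S (dm S (sproj T)) (pullO S (sproj T) (pullO S i A));
          \<pi>s = restr S (sproj T) (pullO S i A)
      in \<forall>k. G k \<in> hom (HS (k - 1)) (HZ (k - 2 * int r)) \<and>
        kernel (HZ (k - 2 * int r)) (HZ k) (euler_mult S i A r e k) = G k ` carrier (HS (k - 1)) \<and>
        kernel (HZ k) (HS k) (\<pi>s k) = euler_mult S i A r e k ` carrier (HZ (k - 2 * int r)) \<and>
        kernel (HS (k - 1)) (HZ (k - 2 * int r)) (G k) = \<pi>s (k - 1) ` carrier (HZ (k - 1)))"

text \<open>The localisation sequence of \<open>(D(N), D(N) - Z)\<close>, read through the identifications
  \<open>exc \<circ> Th\<close>, \<open>zsec_restr\<close> and \<open>sphere_restr\<close>, is the Gysin sequence.\<close>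

definition localisation_is_gysin :: "('s, 'f, 'o, 'm) coefficient_system \<Rightarrow> 'f \<Rightarrow>
    ('o, 'm) recollement \<Rightarrow> 'f normal_data \<Rightarrow> ('o, 'm) recollement \<Rightarrow> 'o \<Rightarrow> nat \<Rightarrow> 'm \<Rightarrow> 'm \<Rightarrow>
    (int \<Rightarrow> 'm \<Rightarrow> 'm) \<Rightarrow> (int \<Rightarrow> 'm \<Rightarrow> 'm) \<Rightarrow> bool" where
  "localisation_is_gysin S i R T Rn A r e \<phi> Th G \<longleftrightarrow>
     (let B = pullO S (tube T) A in \<forall>k.
       (\<forall>\<beta> \<in> carrier (coh S (dm S i) (pullO S i A) (k - 2 * int r)).
          zsec_restr S T A k (forg S (zsec T) Rn B k (exc S i R T Rn A k (Th k \<beta>))) =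
            euler_mult S i A r e k \<beta>) \<and>
       (\<forall>y \<in> carrier (coh S (dm S (tube T)) B k).
          sphere_restr S T A \<phi> k (restr S (punc T) B k y) =
            restr S (sproj T) (pullO S i A) k (zsec_restr S T A k y)) \<and>
       (\<forall>z \<in> carrier (coh S (dm S (punc T)) (puncO S T A) (k - 1)).
          exc S i R T Rn A k (Th k (G k (sphere_restr S T A \<phi> (k - 1) z))) =
            delta S (punc T) Rn B (k - 1) z))"

end

theory Submission
  imports Defs
begin

text \<open>Purity factors \<open>\<union> e(N)\<close> as \<open>i\<^sup>* \<circ> forg \<circ> Th\<close>. Since \<open>\<union> e(N)\<close> and \<open>Th\<close> are bijective in degree
  \<open>d\<close>, \<open>forg : H\<^sup>d\<^sub>Z(X; A) \<rightarrow> H\<^sup>d(X; A)\<close> is injective; as \<open>forg \<circ> \<delta> = 0\<close>, the image of \<open>\<delta>\<close> vanishes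
  and supported refinements are unique. One exists because \<open>j\<^sup>* c = 0\<close> says, under the adjunction,
  that \<open>c\<close> dies in \<open>j\<^sub>* j\<^sup>* A\<close>, and \<open>Hom(1, -)\<close> is exact on the localisation triangle. Applying \<open>i\<^sup>*\<close>
  to \<open>forg (Th \<gamma>) = c\<close> identifies \<open>\<gamma>\<close> as \<open>i\<^sup>* c / e(N)\<close>.\<close>

section \<open>Inverses in a category\<close>

lemma (in category) Hom_Obj:
  assumes "f \<in> Hom C a b"
  shows "a \<in> Obj C" "b \<in> Obj C"
  using assms src_Obj trg_Obj by (auto simp: Hom_def)

lemma inverse_arrows_unique:
  assumes "category C" "inverse_arrows C f g" "inverse_arrows C f h"
  shows "g = h"
proof -
  interpret category C by fact
  have f: "f \<in> Hom C (src C f) (trg C f)" and g: "g \<in> Hom C (trg C f) (src C f)"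
    and h: "h \<in> Hom C (trg C f) (src C f)"
    using assms by (auto simp: inverse_arrows_def Hom_def)
  have "(g \<cdot>\<^bsub>C\<^esub> f) \<cdot>\<^bsub>C\<^esub> h = g \<cdot>\<^bsub>C\<^esub> (f \<cdot>\<^bsub>C\<^esub> h)"
    using cmp_assoc[OF h f g] .
  then show ?thesis
    using assms(2,3) idt_left[OF h] idt_right[OF g] by (simp add: inverse_arrows_def)
qed

text \<open>Inverses are unique, so the definite description in \<open>inv_arr\<close> picks out the
  inverse of any isomorphism.\<close>

lemma inverse_arrows_inv_arr:
  assumes "category C" "is_iso C f"
  shows "inverse_arrows C f (inv_arr C f)"
  unfolding inv_arr_def using assms inverse_arrows_unique[OF assms(1)]
  by (metis is_iso_def theI)

section \<open>Zero arrows and signs in additive categories\<close>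

lemma (in additive_category) zerom_Hom:
  assumes "a \<in> Obj C" "b \<in> Obj C"
  shows "zerom C a b \<in> Hom C a b"
proof -
  interpret comm_group "HomG C a b" using Hom_group[OF assms] .
  show ?thesis using one_closed by (simp add: HomG_def)
qed

text \<open>The only idempotent of a group is its neutral element. An additive map sends zero to an
  idempotent, so this yields preservation of zero by composition, shifts and exact functors
  alike.\<close>

lemma (in additive_category) addm_idem_imp_zerom:
  assumes f: "f \<in> Hom C a b" and "addm C f f = f"
  shows "f = zerom C a b"
proof -
  interpret comm_group "HomG C a b" using Hom_group Hom_Obj[OF f] by blast
  show ?thesis using assms l_cancel_one[of f f] by (simp add: HomG_def)
qed

lemma (in additive_category) addm_zerom:
  assumes "a \<in> Obj C" "b \<in> Obj C"
  shows "addm C (zerom C a b) (zerom C a b) = zerom C a b"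
proof -
  interpret comm_group "HomG C a b" using Hom_group[OF assms] .
  show ?thesis using l_one[OF one_closed] by (simp add: HomG_def)
qed

lemma (in additive_category) cmp_zerom_right:
  assumes g: "g \<in> Hom C b c" and a: "a \<in> Obj C"
  shows "g \<cdot> zerom C a b = zerom C a c"
proof -
  have z: "zerom C a b \<in> Hom C a b" using zerom_Hom a Hom_Obj[OF g] by blast
  show ?thesis
    using addm_idem_imp_zerom[OF cmp_Hom[OF z g]] cmp_add_right[OF z z g] addm_zerom a Hom_Obj[OF g]
    by simp
qed

lemma (in additive_category) cmp_zerom_left:
  assumes f: "f \<in> Hom C a b" and c: "c \<in> Obj C"
  shows "zerom C b c \<cdot> f = zerom C a c"
proof -
  have z: "zerom C b c \<in> Hom C b c" using zerom_Hom c Hom_Obj[OF f] by blast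
  show ?thesis
    using addm_idem_imp_zerom[OF cmp_Hom[OF f z]] cmp_add_left[OF f z z] addm_zerom c Hom_Obj[OF f]
    by simp
qed

lemma (in additive_category) negm_Hom:
  assumes f: "f \<in> Hom C a b"
  shows "negm C f \<in> Hom C a b" and addm_negm: "addm C f (negm C f) = zerom C a b"
    and negm_negm: "negm C (negm C f) = f"
proof -
  interpret comm_group "HomG C a b" using Hom_group Hom_Obj[OF f] by blast
  have f': "f \<in> carrier (HomG C a b)" using f by (simp add: HomG_def)
  have n: "negm C f = inv\<^bsub>HomG C a b\<^esub> f" using f by (simp add: negm_def Hom_def)
  show m: "negm C f \<in> Hom C a b" using inv_closed[OF f'] by (simp add: n) (simp add: HomG_def)
  show "addm C f (negm C f) = zerom C a b"
    using r_inv[OF f'] by (simp add: n) (simp add: HomG_def)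
  have "negm C (negm C f) = inv\<^bsub>HomG C a b\<^esub> (negm C f)" using m by (simp add: negm_def Hom_def)
  then show "negm C (negm C f) = f" using inv_inv[OF f'] by (simp add: n)
qed

text \<open>Uniqueness of inverses in the Hom group. Through it the signs produced by rotating
  triangles are moved across composites.\<close>

lemma (in additive_category) negm_unique:
  assumes "f \<in> Hom C a b" "g \<in> Hom C a b" "addm C f g = zerom C a b"
  shows "g = negm C f"
proof -
  interpret comm_group "HomG C a b" using Hom_group Hom_Obj[OF assms(1)] by blast
  have "inv\<^bsub>HomG C a b\<^esub> f = g"
    using assms m_comm[of g f] by (intro inv_equality) (simp_all add: HomG_def)
  then show ?thesis using assms(1) by (simp add: negm_def Hom_def)
qed

lemma (in additive_category) cmp_negm_right:
  assumes f: "f \<in> Hom C a b" and g: "g \<in> Hom C b c"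
  shows "g \<cdot> negm C f = negm C (g \<cdot> f)"
  using negm_unique[OF cmp_Hom[OF f g] cmp_Hom[OF negm_Hom(1)[OF f] g]]
    cmp_add_right[OF f negm_Hom(1)[OF f] g] addm_negm[OF f] cmp_zerom_right[OF g] Hom_Obj[OF f]
  by simp

lemma (in additive_category) cmp_negm_left:
  assumes f: "f \<in> Hom C a b" and g: "g \<in> Hom C b c"
  shows "negm C g \<cdot> f = negm C (g \<cdot> f)"
  using negm_unique[OF cmp_Hom[OF f g] cmp_Hom[OF f negm_Hom(1)[OF g]]]
    cmp_add_left[OF f g negm_Hom(1)[OF g]] addm_negm[OF g] cmp_zerom_left[OF f] Hom_Obj[OF g]
  by simp

lemma (in additive_category) negm_zerom:
  assumes "a \<in> Obj C" "b \<in> Obj C"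
  shows "negm C (zerom C a b) = zerom C a b"
  using negm_unique[OF zerom_Hom zerom_Hom addm_zerom] assms by metis

section \<open>Distinguished triangles and exactness of Hom(w, -)\<close>

lemma (in triangulated_category) shM_zerom:
  assumes "a \<in> Obj C" "b \<in> Obj C"
  shows "shM C n (zerom C a b) = zerom C (shO C n a) (shO C n b)"
proof -
  have z: "zerom C a b \<in> Hom C a b" using zerom_Hom[OF assms] .
  show ?thesis
    using addm_idem_imp_zerom[OF shM_Hom[OF z]] shM_add[OF z z] addm_zerom[OF assms] by simp
qed

lemma (in triangulated_category) tri_Hom:
  assumes "(f, g, h) \<in> tri C"
  shows "f \<in> Hom C (src C f) (trg C f)" "g \<in> Hom C (trg C f) (trg C g)"
    "h \<in> Hom C (trg C g) (shO C 1 (src C f))"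
proof -
  have c: "f \<in> Arr C" "g \<in> Hom C (trg C f) (src C h)" "h \<in> Hom C (trg C g) (shO C 1 (src C f))"
    using tri_candidate[OF assms] by (simp_all only: candidate_triangle_def)
  show "f \<in> Hom C (src C f) (trg C f)" using c(1) by (simp add: Hom_def)
  have "trg C g = src C h" using c(2) by (simp add: Hom_def)
  then show "g \<in> Hom C (trg C f) (trg C g)" using c(2) by simp
  show "h \<in> Hom C (trg C g) (shO C 1 (src C f))" using c(3) .
qed

text \<open>\<open>TR3\<close> names the corners of a triangle through \<open>src\<close> and
  \<open>trg\<close>; here they are read off from Hom memberships, so that the axiom applies
  directly to triangles on known objects.\<close>

lemma (in triangulated_category) tri_fill:
  assumes t: "(f, g, h) \<in> tri C" "(f', g', h') \<in> tri C"
    and f: "f \<in> Hom C a b" and g: "g \<in> Hom C b c"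
    and f': "f' \<in> Hom C a' b'" and g': "g' \<in> Hom C b' c'"
    and u: "u \<in> Hom C a a'" and v: "v \<in> Hom C b b'" and vf: "v \<cdot> f = f' \<cdot> u"
  obtains w where "w \<in> Hom C c c'" "w \<cdot> g = g' \<cdot> v" "shM C 1 u \<cdot> h = h' \<cdot> w"
proof -
  have ends: "src C f = a" "src C f' = a'" "src C g = b" "src C g' = b'" "src C h = c" "src C h' = c'"
    using tri_Hom(3)[OF t(1)] tri_Hom(3)[OF t(2)] f g f' g' by (simp_all add: Hom_def)
  have "\<exists>w \<in> Hom C c c'. w \<cdot> g = g' \<cdot> v \<and> shM C 1 u \<cdot> h = h' \<cdot> w"
    using TR3[OF t, of u v] u v vf by (simp add: ends)
  then show thesis
    by (elim bexE conjE) (rule that)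
qed

text \<open>The identity and \<open>f\<close> map the trivial triangle on \<open>src C f\<close> to
  \<open>(f, g, h)\<close>; completing this pair by \<open>TR3\<close> factors
  \<open>g \<cdot> f\<close> through a zero object.\<close>

lemma (in triangulated_category) tri_cmp:
  assumes t: "(f, g, h) \<in> tri C"
  shows "g \<cdot> f = zerom C (src C f) (trg C g)"
proof -
  obtain z where z: "is_zero C z" using zero_object by blast
  then have zO: "z \<in> Obj C" by (simp add: is_zero_def)
  note H = tri_Hom[OF t]
  have a: "src C f \<in> Obj C" using Hom_Obj[OF H(1)] by simp
  have idt: "idt C (src C f) \<in> Hom C (src C f) (src C f)" using idt_Hom[OF a] .
  have za: "zerom C (src C f) z \<in> Hom C (src C f) z" using zerom_Hom[OF a zO] .
  obtain w where w: "w \<in> Hom C z (trg C g)" "w \<cdot> zerom C (src C f) z = g \<cdot> f"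
    using tri_fill[OF TR1_idt[OF a z] t idt za H(1,2) idt H(1)] by blast
  show ?thesis using cmp_zerom_right[OF w(1) a] w(2) by simp
qed

text \<open>Two rotations make \<open>h\<close> and the negative of \<open>shM C 1 f\<close> the
  first two maps of a triangle, so their composite vanishes by \<open>tri_cmp\<close>; the sign is
  then removed.\<close>

lemma (in triangulated_category) tri_boundary:
  assumes t: "(f, g, h) \<in> tri C"
  shows "shM C 1 f \<cdot> h = zerom C (src C h) (shO C 1 (trg C f))"
proof -
  note H = tri_Hom[OF t]
  have f1: "shM C 1 f \<in> Hom C (shO C 1 (src C f)) (shO C 1 (trg C f))" using shM_Hom[OF H(1)] .
  have r1: "(g, h, negm C (shM C 1 f)) \<in> tri C" using TR2[OF tri_candidate[OF t]] t by simp
  then have r2: "(h, negm C (shM C 1 f), negm C (shM C 1 g)) \<in> tri C"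
    using TR2[OF tri_candidate[OF r1]] by simp
  have "negm C (shM C 1 f \<cdot> h) = zerom C (trg C g) (shO C 1 (trg C f))"
    using tri_cmp[OF r2] cmp_negm_left[OF H(3) f1] negm_Hom(1)[OF f1] H(3) by (simp add: Hom_def)
  moreover have "shM C 1 f \<cdot> h \<in> Hom C (trg C g) (shO C 1 (trg C f))" using cmp_Hom[OF H(3) f1] .
  ultimately show ?thesis
    using negm_negm negm_zerom Hom_Obj H(3) by (metis (mono_tags, lifting) Hom_def mem_Collect_eq)
qed

lemma (in triangulated_category) tri_exact:
  assumes t: "(f, g, h) \<in> tri C" and b: "b \<in> Hom C w (trg C f)"
    and gb: "g \<cdot> b = zerom C w (trg C g)"
  obtains x where "x \<in> Hom C w (src C f)" "f \<cdot> x = b"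
proof -
  obtain z where z: "is_zero C z" using zero_object by blast
  then have zO: "z \<in> Obj C" by (simp add: is_zero_def)
  note H = tri_Hom[OF t]
  have wO: "w \<in> Obj C" using Hom_Obj[OF b] by simp
  have f1: "shM C 1 f \<in> Hom C (shO C 1 (src C f)) (shO C 1 (trg C f))" using shM_Hom[OF H(1)] .
  have b1: "shM C 1 b \<in> Hom C (shO C 1 w) (shO C 1 (trg C f))" using shM_Hom[OF b] .
  have w1: "idt C (shO C 1 w) \<in> Hom C (shO C 1 w) (shO C 1 w)" using idt_Hom[OF shO_Obj[OF wO]] .
  have r: "(g, h, negm C (shM C 1 f)) \<in> tri C" using TR2[OF tri_candidate[OF t]] t by simp
  have tw: "(idt C w, zerom C w z, zerom C z (shO C 1 w)) \<in> tri C" using TR1_idt[OF wO z] .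
  have rw: "(zerom C w z, zerom C z (shO C 1 w), negm C (idt C (shO C 1 w))) \<in> tri C"
    using TR2[OF tri_candidate[OF tw]] tw shM_idt[OF wO] by simp
  have zw: "zerom C w z \<in> Hom C w z" using zerom_Hom[OF wO zO] .
  have zw1: "zerom C z (shO C 1 w) \<in> Hom C z (shO C 1 w)" using zerom_Hom[OF zO shO_Obj[OF wO]] .
  have cO: "trg C g \<in> Obj C" using Hom_Obj[OF H(2)] by simp
  have zc: "zerom C z (trg C g) \<in> Hom C z (trg C g)" using zerom_Hom[OF zO cO] .
  \<comment> \<open>A morphism from the rotated trivial triangle \<open>w \<rightarrow> 0 \<rightarrow> w[1]\<close> to the rotation of \<open>(f, g, h)\<close>
    extends \<open>b\<close>; its third component, shifted back, is the lift.\<close>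
  obtain y where y: "y \<in> Hom C (shO C 1 w) (shO C 1 (src C f))"
    "shM C 1 b \<cdot> negm C (idt C (shO C 1 w)) = negm C (shM C 1 f) \<cdot> y"
    using tri_fill[OF rw r zw zw1 H(2,3) b zc] gb cmp_zerom_right[OF zc wO] by metis
  \<comment> \<open>Rotation has put one sign on each side of the square; as negation is an
    involution, they cancel.\<close>
  have "negm C (shM C 1 b) = negm C (shM C 1 f \<cdot> y)"
    using y(2) cmp_negm_right[OF w1 b1] cmp_negm_left[OF y(1) f1] idt_right[OF b1] by simp
  then have fy: "shM C 1 b = shM C 1 f \<cdot> y"
    using negm_negm[OF b1] negm_negm[OF cmp_Hom[OF y(1) f1]] by metis
  have unshift: "shM C (-1) (shM C 1 k) = k" if "k \<in> Hom C p q" for k p q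
    using that shM_plus[of k 1 "-1"] shM_0[of k] by (simp add: Hom_def)
  have unshiftO: "shO C (-1) (shO C 1 p) = p" if "p \<in> Obj C" for p
    using that shO_plus[of p 1 "-1"] shO_0[of p] by simp
  show ?thesis
  proof (rule that)
    show "shM C (-1) y \<in> Hom C w (src C f)"
      using shM_Hom[OF y(1), of "-1"] unshiftO wO Hom_Obj[OF H(1)] by simp
    show "f \<cdot> shM C (-1) y = b"
      using shM_cmp[OF y(1) f1, of "-1"] fy unshift[OF b] unshift[OF H(1)] by simp
  qed
qed

text \<open>Shifting a triangle by an odd degree introduces a sign. Therefore the arrow
  \<open>y\<close> is shifted by \<open>-n\<close> instead, lifted by \<open>tri_exact\<close> and
  shifted back, with no sign to track.\<close>

lemma (in triangulated_category) shifted_tri_exact: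
  assumes t: "(f, g, h) \<in> tri C" and f: "f \<in> Hom C a b" and g: "g \<in> Hom C b c"
    and y: "y \<in> Hom C w (shO C n b)" and gy: "shM C n g \<cdot> y = zerom C w (shO C n c)"
  obtains x where "x \<in> Hom C w (shO C n a)" "shM C n f \<cdot> x = y"
proof -
  have shO_inv: "shO C (- m) (shO C m p) = p" if "p \<in> Obj C" for p m
    using that shO_plus[of p m "- m"] shO_0[of p] by simp
  have shM_inv: "shM C (- m) (shM C m k) = k" if "k \<in> Hom C p q" for k p q m
    using that shM_plus[of k m "- m"] shM_0[of k] by (simp add: Hom_def)
  have wO: "w \<in> Obj C" using Hom_Obj[OF y] by simp
  have y': "shM C (-n) y \<in> Hom C (shO C (-n) w) b"
    using shM_Hom[OF y, of "-n"] shO_inv Hom_Obj[OF f] by simp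
  have "g \<cdot> shM C (-n) y = shM C (-n) (shM C n g \<cdot> y)"
    using shM_cmp[OF y shM_Hom[OF g], of "-n"] shM_inv[OF g] by simp
  also have "\<dots> = zerom C (shO C (-n) w) c"
    using gy shM_zerom wO shO_Obj shO_inv Hom_Obj[OF g] by simp
  finally obtain x where x: "x \<in> Hom C (shO C (-n) w) a" "f \<cdot> x = shM C (-n) y"
    using tri_exact[OF t, of "shM C (-n) y" "shO C (-n) w"] y' f g by (simp add: Hom_def) metis
  show ?thesis
  proof (rule that)
    show "shM C n x \<in> Hom C w (shO C n a)"
      using shM_Hom[OF x(1), of n] shO_inv[OF wO, of "-n"] by simp
    show "shM C n f \<cdot> shM C n x = y"
      using shM_cmp[OF x(1) f, of n] x(2) shM_inv[OF y, of "-n"] by simp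
  qed
qed

text \<open>As \<open>h\<close> ends in \<open>a[1]\<close>, its shift by \<open>n - 1\<close> ends
  in \<open>a[n]\<close>, where the shift of \<open>f\<close> by \<open>n\<close> starts. Their
  composite is the shift by \<open>n - 1\<close> of the one that vanishes by
  \<open>tri_boundary\<close>. This supplies the relation that \<open>forg\<close> kills the image
  of \<open>delta\<close>.\<close>

lemma (in triangulated_category) shifted_tri_boundary:
  assumes t: "(f, g, h) \<in> tri C" and f: "f \<in> Hom C a b" and h: "h \<in> Hom C c (shO C 1 a)"
    and y: "y \<in> Hom C w (shO C (n - 1) c)"
  shows "shM C (n - 1) h \<cdot> y \<in> Hom C w (shO C n a)"
    and "shM C n f \<cdot> shM C (n - 1) h \<cdot> y = zerom C w (shO C n b)"
proof -
  have aO: "a \<in> Obj C" and bO: "b \<in> Obj C" and cO: "c \<in> Obj C"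
    using Hom_Obj[OF f] Hom_Obj[OF h] by simp_all
  have sa: "shO C (n - 1) (shO C 1 p) = shO C n p" if "p \<in> Obj C" for p
    using shO_plus[OF that, of 1 "n - 1"] by simp
  have h': "shM C (n - 1) h \<in> Hom C (shO C (n - 1) c) (shO C n a)"
    using shM_Hom[OF h, of "n - 1"] sa[OF aO] by simp
  have f1: "shM C 1 f \<in> Hom C (shO C 1 a) (shO C 1 b)" using shM_Hom[OF f] .
  have f': "shM C n f = shM C (n - 1) (shM C 1 f)"
    using shM_plus[of f 1 "n - 1"] f by (simp add: Hom_def)
  show "shM C (n - 1) h \<cdot> y \<in> Hom C w (shO C n a)" using cmp_Hom[OF y h'] .
  have "shM C n f \<cdot> shM C (n - 1) h = shM C (n - 1) (shM C 1 f \<cdot> h)"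
    using shM_cmp[OF h f1, of "n - 1"] f' by simp
  also have "\<dots> = zerom C (shO C (n - 1) c) (shO C n b)"
    using tri_boundary[OF t] f h shM_zerom[OF cO shO_Obj[OF bO]] sa[OF bO] by (simp add: Hom_def)
  finally show "shM C n f \<cdot> shM C (n - 1) h \<cdot> y = zerom C w (shO C n b)"
    using cmp_assoc[OF y h' shM_Hom[OF f]] cmp_zerom_left[OF y shO_Obj[OF bO]] by simp
qed

section \<open>Functors, restriction and adjoint transposes\<close>

lemma (in exact_functor) mmap_zerom:
  assumes "a \<in> Obj C" "b \<in> Obj C"
  shows "mmap F (zerom C a b) = zerom D (omap F a) (omap F b)"
proof -
  have z: "zerom C a b \<in> Hom C a b" using C.zerom_Hom[OF assms] .
  show ?thesis
    using D.addm_idem_imp_zerom[OF mmap_Hom[OF z]] mmap_add[OF z z] C.addm_zerom[OF assms] by simp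
qed

lemma (in tensor_functor) restr_Hom:
  assumes "A \<in> Obj C" and a: "a \<in> Hom C (unt C) (shO C n A)"
  shows "shc F A n \<cdot>\<^bsub>D\<^esub> mmap F a \<cdot>\<^bsub>D\<^esub> one_cmp F \<in> Hom D (unt D) (shO D n (omap F A))"
  using D.cmp_Hom[OF D.cmp_Hom[OF one_cmp_Hom mmap_Hom[OF a]] shc_Hom[OF assms(1)]] .

lemma (in tensor_functor) inv_one_cmp:
  shows "inv_arr D (one_cmp F) \<in> Hom D (omap F (unt C)) (unt D)"
    and "one_cmp F \<cdot>\<^bsub>D\<^esub> inv_arr D (one_cmp F) = idt D (omap F (unt C))"
  using inverse_arrows_inv_arr[OF D.category_axioms one_cmp_iso] one_cmp_Hom
  by (auto simp: inverse_arrows_def Hom_def)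

lemma (in coefficient_system) transpose_up_Hom:
  assumes f: "f \<in> Arr (spaces S)" and B: "B \<in> Obj (cat S (dm S f))"
    and z: "z \<in> Hom (cat S (dm S f)) (unt (cat S (dm S f))) (shO (cat S (dm S f)) n B)"
  shows "transpose_up S f B n z \<in>
    Hom (cat S (cd S f)) (unt (cat S (cd S f))) (shO (cat S (cd S f)) n (pushO S f B))"
proof -
  let ?Y = "cat S (cd S f)" and ?X = "cat S (dm S f)"
  interpret F: tensor_functor ?Y ?X "pull S f" using pull[OF f] .
  interpret A: exact_adjunction ?Y ?X "pull S f" "push S f" "aunit S f" "acounit S f" using adj[OF f] .
  show ?thesis
    unfolding transpose_up_def
    using F.C.cmp_Hom[OF F.C.cmp_Hom[OF F.C.cmp_Hom[OF A.eta_Hom[OF F.C.unt_Obj]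
      A.R.mmap_Hom[OF F.inv_one_cmp(1)]] A.R.mmap_Hom[OF z]] A.R.shc_Hom[OF B]] .
qed

text \<open>Exact functors and composition with fixed arrows preserve zero. This carries the
  vanishing of the restriction of \<open>c\<close> to \<open>U\<close> over to its transpose on
  \<open>X\<close>.\<close>

lemma (in coefficient_system) transpose_up_zero:
  assumes f: "f \<in> Arr (spaces S)" and B: "B \<in> Obj (cat S (dm S f))"
  shows "transpose_up S f B n (zerom (cat S (dm S f)) (unt (cat S (dm S f))) (shO (cat S (dm S f)) n B)) =
    zerom (cat S (cd S f)) (unt (cat S (cd S f))) (shO (cat S (cd S f)) n (pushO S f B))"
proof -
  let ?Y = "cat S (cd S f)" and ?X = "cat S (dm S f)"
  interpret F: tensor_functor ?Y ?X "pull S f" using pull[OF f] .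
  interpret A: exact_adjunction ?Y ?X "pull S f" "push S f" "aunit S f" "acounit S f" using adj[OF f] .
  have nB: "shO ?X n B \<in> Obj ?X" using F.D.shO_Obj[OF B] .
  have v: "mmap (push S f) (inv_arr ?X (one_cmp (pull S f))) \<cdot>\<^bsub>?Y\<^esub> aunit S f (unt ?Y) \<in>
      Hom ?Y (unt ?Y) (pushO S f (unt ?X))"
    using F.C.cmp_Hom[OF A.eta_Hom[OF F.C.unt_Obj] A.R.mmap_Hom[OF F.inv_one_cmp(1)]] .
  show ?thesis
    unfolding transpose_up_def
    using A.R.mmap_zerom[OF F.D.unt_Obj nB] F.C.cmp_zerom_left[OF v A.R.omap_Obj[OF nB]]
      F.C.cmp_zerom_right[OF A.R.shc_Hom[OF B] F.C.unt_Obj]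
    by simp
qed

text \<open>Naturality of the unit, together with its compatibility with shifts, gives this. It
  translates restriction to \<open>U\<close> into the second map of the localisation triangle, so
  that exactness of Hom out of the unit object can be applied.\<close>

lemma (in coefficient_system) transpose_up_restr:
  assumes f: "f \<in> Arr (spaces S)" and A: "A \<in> Obj (cat S (cd S f))"
    and a: "a \<in> Hom (cat S (cd S f)) (unt (cat S (cd S f))) (shO (cat S (cd S f)) n A)"
  shows "transpose_up S f (pullO S f A) n (restr S f A n a) =
    shM (cat S (cd S f)) n (aunit S f A) \<cdot>\<^bsub>cat S (cd S f)\<^esub> a"
proof -
  let ?Y = "cat S (cd S f)" and ?X = "cat S (dm S f)"
  interpret F: tensor_functor ?Y ?X "pull S f" using pull[OF f] .
  interpret A: exact_adjunction ?Y ?X "pull S f" "push S f" "aunit S f" "acounit S f" using adj[OF f] .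
  let ?p = "mmap (push S f)" and ?q = "mmap (pull S f)" and ?o = "one_cmp (pull S f)"
  let ?s = "shc (pull S f) A n" and ?t = "shc (push S f) (pullO S f A) n"
  let ?v = "inv_arr ?X ?o" and ?e = "aunit S f"
  have s: "?s \<in> Hom ?X (pullO S f (shO ?Y n A)) (shO ?X n (pullO S f A))" using F.shc_Hom[OF A] .
  have qa: "?q a \<in> Hom ?X (pullO S f (unt ?Y)) (pullO S f (shO ?Y n A))" using F.mmap_Hom[OF a] .
  have o: "?o \<in> Hom ?X (unt ?X) (pullO S f (unt ?Y))" using F.one_cmp_Hom .
  have v: "?v \<in> Hom ?X (pullO S f (unt ?Y)) (unt ?X)" using F.inv_one_cmp(1) .
  have eu: "?e (unt ?Y) \<in> Hom ?Y (unt ?Y) (pushO S f (pullO S f (unt ?Y)))"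
    using A.eta_Hom[OF F.C.unt_Obj] .
  have en: "?e (shO ?Y n A) \<in> Hom ?Y (shO ?Y n A) (pushO S f (pullO S f (shO ?Y n A)))"
    using A.eta_Hom[OF F.C.shO_Obj[OF A]] .
  have t: "?t \<in> Hom ?Y (pushO S f (shO ?X n (pullO S f A))) (shO ?Y n (pushO S f (pullO S f A)))"
    using A.R.shc_Hom[OF F.omap_Obj[OF A]] .
  have qo: "?q a \<cdot>\<^bsub>?X\<^esub> ?o \<in> Hom ?X (unt ?X) (pullO S f (shO ?Y n A))" using F.D.cmp_Hom[OF o qa] .
  have z: "?s \<cdot>\<^bsub>?X\<^esub> ?q a \<cdot>\<^bsub>?X\<^esub> ?o \<in> Hom ?X (unt ?X) (shO ?X n (pullO S f A))"
    using F.D.cmp_Hom[OF qo s] .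
  \<comment> \<open>The comparison of unit objects with which \<open>restr\<close> starts meets the
    inverse inserted by \<open>transpose_up\<close>, and the two cancel.\<close>
  have "(?s \<cdot>\<^bsub>?X\<^esub> ?q a \<cdot>\<^bsub>?X\<^esub> ?o) \<cdot>\<^bsub>?X\<^esub> ?v = ?s \<cdot>\<^bsub>?X\<^esub> ?q a"
    using F.D.cmp_assoc[OF v qo s] F.D.cmp_assoc[OF v o qa] F.inv_one_cmp(2) F.D.idt_right[OF qa]
    by simp
  then have "?p (?s \<cdot>\<^bsub>?X\<^esub> ?q a \<cdot>\<^bsub>?X\<^esub> ?o) \<cdot>\<^bsub>?Y\<^esub> ?p ?v = ?p ?s \<cdot>\<^bsub>?Y\<^esub> ?p (?q a)"
    using A.R.mmap_cmp[OF v z] A.R.mmap_cmp[OF qa s] by simp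
  then have "?p (?s \<cdot>\<^bsub>?X\<^esub> ?q a \<cdot>\<^bsub>?X\<^esub> ?o) \<cdot>\<^bsub>?Y\<^esub> ?p ?v \<cdot>\<^bsub>?Y\<^esub> ?e (unt ?Y) =
      ?p ?s \<cdot>\<^bsub>?Y\<^esub> ?p (?q a) \<cdot>\<^bsub>?Y\<^esub> ?e (unt ?Y)"
    using F.C.cmp_assoc[OF eu A.R.mmap_Hom[OF v] A.R.mmap_Hom[OF z]]
      F.C.cmp_assoc[OF eu A.R.mmap_Hom[OF qa] A.R.mmap_Hom[OF s]]
    by simp
  \<comment> \<open>Naturality of the unit at \<open>a\<close> brings \<open>a\<close> to the right
    end of the composite; the three arrows then left of it form the left side of
    \<open>eta_shift\<close>.\<close>
  also have "\<dots> = ?p ?s \<cdot>\<^bsub>?Y\<^esub> ?e (shO ?Y n A) \<cdot>\<^bsub>?Y\<^esub> a"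
    using A.eta_nat[OF a] by simp
  finally have "transpose_up S f (pullO S f A) n (restr S f A n a) =
      ?t \<cdot>\<^bsub>?Y\<^esub> ?p ?s \<cdot>\<^bsub>?Y\<^esub> ?e (shO ?Y n A) \<cdot>\<^bsub>?Y\<^esub> a"
    by (simp add: transpose_up_def restr_def)
  also have "\<dots> = (?t \<cdot>\<^bsub>?Y\<^esub> ?p ?s \<cdot>\<^bsub>?Y\<^esub> ?e (shO ?Y n A)) \<cdot>\<^bsub>?Y\<^esub> a"
    using F.C.cmp_assoc[OF a F.C.cmp_Hom[OF en A.R.mmap_Hom[OF s]] t]
      F.C.cmp_assoc[OF a en A.R.mmap_Hom[OF s]] by simp
  finally show ?thesis using A.eta_shift[OF A] by simp
qed

section \<open>Secondary group, localisation torsor and Euler division\<close>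

theorem corollary4p9:
  fixes S :: "('s, 'f, 'o, 'm) coefficient_system"
    and i j :: 'f and R Rn :: "('o, 'm) recollement" and T :: "'f normal_data"
    and A :: 'o and r :: nat and d :: int and u e \<phi> c :: 'm
    and Th G :: "int \<Rightarrow> 'm \<Rightarrow> 'm"
  assumes system: "coefficient_system S"
    and recollement: "recollement S i j R"
    and coefficients: "A \<in> Obj (cat S (cd S i))"
    and tubular: "tubular_neighbourhood S i j T"
    and recollement_disk: "recollement S (zsec T) (punc T) Rn"
    and oriented: "orientation S T Rn r u"
    and euler: "e = euler_class S T Rn r u"
    and excision: "excision S i R T Rn A \<phi>"
    and thom: "thom_isomorphism S i R A r e Th"
    and gysin: "gysin_sequence S i T A r e G"
    and gysin_comparison: "localisation_is_gysin S i R T Rn A r e \<phi> Th G"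
    and euler_iso: "euler_mult S i A r e d \<in>
      iso (coh S (dm S i) (pullO S i A) (d - 2 * int r)) (coh S (dm S i) (pullO S i A) d)"
    and cls: "c \<in> carrier (coh S (cd S i) A d)"
    and restricts_to_zero: "restr S j A d c = \<one>\<^bsub>coh S (dm S j) (pullO S j A) d\<^esub>"
  shows "secondary_group S j R A d = {\<one>\<^bsub>supp_coh S i R A d\<^esub>} \<and>
    is_singleton (localisation_torsor S i R A d c) \<and>
    (\<exists>!\<gamma>. \<gamma> \<in> carrier (coh S (dm S i) (pullO S i A) (d - 2 * int r)) \<and>
       euler_mult S i A r e d \<gamma> = restr S i A d c) \<and>
    supported_lifts S i R A d c = {Th d (euler_quotient S i A r e d (restr S i A d c))} \<and>
    localised_class S i R A d c =
      supp_adj S i R A d (Th d (euler_quotient S i A r e d (restr S i A d c)))"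
proof -
  interpret recollement S i j R by fact
  let ?X = "cat S (cd S i)" and ?U = "cat S (dm S j)" and ?Z = "cat S (dm S i)"
  let ?HZ = "coh S (dm S i) (pullO S i A) (d - 2 * int r)" and ?HX = "supp_coh S i R A d"
  let ?E = "euler_mult S i A r e d"
  have tX: "tensor_category ?X" and tU: "tensor_category ?U"
    using coefficient_system.pull[OF system i_Arr] coefficient_system.pull[OF system j_Arr] same_target
    by (auto simp: tensor_functor_def)
  interpret X: tensor_category ?X by fact
  interpret U: tensor_category ?U by fact
  have fi: "tensor_functor ?X ?Z (pull S i)"
    using coefficient_system.pull[OF system i_Arr] .
  have fj: "tensor_functor ?X ?U (pull S j)"
    using coefficient_system.pull[OF system j_Arr] same_target by simp
  have c_Hom: "c \<in> Hom ?X (unt ?X) (shO ?X d A)"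
    using cls by (simp add: coh_def HomG_def)
  have tri: "(ieps R A, aunit S j A, bdry R A) \<in> tri ?X"
    using closed_open[OF coefficients] .
  have ieps: "ieps R A \<in> Hom ?X (supp S i R A) A"
    using exact_adjunction.eps_Hom[OF adj_i coefficients] by (simp add: supp_def)
  have aunit: "aunit S j A \<in> Hom ?X A (pushO S j (pullO S j A))"
    using exact_adjunction.eta_Hom[OF coefficient_system.adj[OF system j_Arr]] coefficients same_target
    by simp
  have bdry: "bdry R A \<in> Hom ?X (pushO S j (pullO S j A)) (shO ?X 1 (supp S i R A))"
    using X.tri_Hom(3)[OF tri] ieps aunit by (simp add: Hom_def)
  have jA: "pullO S j A \<in> Obj ?U"
    using exact_functor.omap_Obj[OF tensor_functor.axioms(3)[OF fj] coefficients] .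
  have suppA: "supp S i R A \<in> Obj ?X"
    using X.Hom_Obj[OF ieps] by simp
  have zero_HX: "\<one>\<^bsub>?HX\<^esub> = zerom ?X (unt ?X) (shO ?X d (supp S i R A))"
    by (simp add: supp_coh_def coh_def HomG_def)
  have group_HX: "group ?HX"
    using comm_group.axioms(2)[OF X.Hom_group[OF X.unt_Obj X.shO_Obj[OF suppA]]]
    by (simp add: supp_coh_def coh_def)
  have Th: "Th d \<in> iso ?HZ ?HX"
    and restr_Th: "\<And>\<beta>. \<beta> \<in> carrier ?HZ \<Longrightarrow> restr S i A d (forg S i R A d (Th d \<beta>)) = ?E \<beta>"
    using thom by (simp_all add: thom_isomorphism_def)
  have Th_bij: "bij_betw (Th d) (carrier ?HZ) (carrier ?HX)"
    using Th by (simp add: iso_def)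
  have E_bij: "bij_betw ?E (carrier ?HZ) (carrier (coh S (dm S i) (pullO S i A) d))"
    using euler_iso by (simp add: iso_def)
  have forg_inj: "inj_on (forg S i R A d) (carrier ?HX)"
  proof (rule inj_onI)
    \<comment> \<open>Both classes are written as Thom images. Restricting their common image under
      \<open>forg\<close> to \<open>Z\<close> gives equal Euler multiples, by the self-intersection
      formula \<open>restr_Th\<close>.\<close>
    fix x y assume xy: "x \<in> carrier ?HX" "y \<in> carrier ?HX" "forg S i R A d x = forg S i R A d y"
    then obtain \<beta> \<gamma> where \<beta>: "\<beta> \<in> carrier ?HZ" "x = Th d \<beta>" and \<gamma>: "\<gamma> \<in> carrier ?HZ" "y = Th d \<gamma>"
      unfolding bij_betw_imp_surj_on[OF Th_bij, symmetric] by (elim imageE)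
    then have "?E \<beta> = ?E \<gamma>"
      using restr_Th[OF \<beta>(1)] restr_Th[OF \<gamma>(1)] xy(3) by simp
    then show "x = y"
      using inj_onD[OF bij_betw_imp_inj_on[OF E_bij] _ \<beta>(1) \<gamma>(1)] \<beta>(2) \<gamma>(2) by simp
  qed
  have restr_c: "restr S i A d c \<in> carrier (coh S (dm S i) (pullO S i A) d)"
    using tensor_functor.restr_Hom[OF fi coefficients c_Hom] by (simp add: coh_def HomG_def restr_def)
  \<comment> \<open>Surjectivity of \<open>?E\<close> gives the quotient and injectivity its
    uniqueness; this is also what makes the description in \<open>euler_quotient\<close>
    denote.\<close>
  have ex1: "\<exists>!\<gamma>. \<gamma> \<in> carrier ?HZ \<and> ?E \<gamma> = restr S i A d c"
  proof -
    obtain \<gamma> where \<gamma>: "\<gamma> \<in> carrier ?HZ" "restr S i A d c = ?E \<gamma>"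
      using restr_c unfolding bij_betw_imp_surj_on[OF E_bij, symmetric] by (rule imageE)
    show ?thesis
      using \<gamma> inj_onD[OF bij_betw_imp_inj_on[OF E_bij]] by (intro ex1I[of _ \<gamma>]) simp_all
  qed
  \<comment> \<open>Any refinement is the Thom image of some \<gamma>, and restricting to
    \<open>Z\<close> forces \<gamma> to be the Euler quotient. This bounds the set of refinements by
    one explicit element before any is known to exist.\<close>
  have lift_eq: "x = Th d (euler_quotient S i A r e d (restr S i A d c))"
    if x: "x \<in> supported_lifts S i R A d c" for x
  proof -
    obtain \<gamma> where \<gamma>: "\<gamma> \<in> carrier ?HZ" "x = Th d \<gamma>"
      using x unfolding supported_lifts_def bij_betw_imp_surj_on[OF Th_bij, symmetric]
      by (elim CollectE conjE imageE)
    then have "?E \<gamma> = restr S i A d c"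
      using x restr_Th[OF \<gamma>(1)] by (simp add: supported_lifts_def)
    then have "euler_quotient S i A r e d (restr S i A d c) = \<gamma>"
      unfolding euler_quotient_def using ex1 \<gamma>(1) by (intro the1_equality) simp_all
    then show ?thesis using \<gamma>(2) by simp
  qed
  \<comment> \<open>Existence comes from the triangle. For the Thom image of the Euler quotient, the
    formula \<open>restr_Th\<close> shows only that its image under \<open>forg\<close> agrees with
    \<open>c\<close> after restriction to \<open>Z\<close>, and that restriction is not assumed
    injective on the cohomology of \<open>X\<close>.\<close>
  obtain x where x: "x \<in> supported_lifts S i R A d c"
  proof -
    have "shM ?X d (aunit S j A) \<cdot>\<^bsub>?X\<^esub> c = transpose_up S j (pullO S j A) d (restr S j A d c)"
      using coefficient_system.transpose_up_restr[OF system j_Arr, of A c d] coefficients c_Hom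
      by (simp add: same_target)
    also have "\<dots> = zerom ?X (unt ?X) (shO ?X d (pushO S j (pullO S j A)))"
      using coefficient_system.transpose_up_zero[OF system j_Arr jA] restricts_to_zero same_target
      by (simp add: coh_def HomG_def)
    finally obtain x where "x \<in> Hom ?X (unt ?X) (shO ?X d (supp S i R A))"
      "shM ?X d (ieps R A) \<cdot>\<^bsub>?X\<^esub> x = c"
      using X.shifted_tri_exact[OF tri ieps aunit c_Hom] by blast
    then show ?thesis
      by (intro that) (simp add: supported_lifts_def supp_coh_def coh_def HomG_def forg_def coef_def)
  qed
  have lifts: "supported_lifts S i R A d c = {Th d (euler_quotient S i A r e d (restr S i A d c))}"
    using x lift_eq by blast
  \<comment> \<open>Both \<open>delta\<close> of \<open>z\<close> and the neutral element are sent
    to zero by \<open>forg\<close>, so injectivity of \<open>forg\<close> identifies them. The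
    degree \<open>d - 1\<close> makes the boundary map land in degree \<open>d\<close>.\<close>
  have delta_zero: "delta S j R A (d - 1) z = \<one>\<^bsub>?HX\<^esub>"
    if z: "z \<in> carrier (coh S (dm S j) (pullO S j A) (d - 1))" for z
  proof -
    have "transpose_up S j (pullO S j A) (d - 1) z \<in>
        Hom ?X (unt ?X) (shO ?X (d - 1) (pushO S j (pullO S j A)))"
      using coefficient_system.transpose_up_Hom[OF system j_Arr jA] z same_target
      by (simp add: coh_def HomG_def)
    from X.shifted_tri_boundary[OF tri ieps bdry this]
    have "delta S j R A (d - 1) z \<in> carrier ?HX"
      "forg S i R A d (delta S j R A (d - 1) z) = zerom ?X (unt ?X) (shO ?X d A)"
      by (simp_all add: delta_def coef_def forg_def supp_coh_def coh_def HomG_def same_target)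
    moreover have "forg S i R A d \<one>\<^bsub>?HX\<^esub> = zerom ?X (unt ?X) (shO ?X d A)"
      using X.cmp_zerom_right[OF X.shM_Hom[OF ieps] X.unt_Obj]
      by (simp add: forg_def coef_def zero_HX)
    moreover have "\<one>\<^bsub>?HX\<^esub> \<in> carrier ?HX"
      using group.is_monoid[OF group_HX] by (rule monoid.one_closed)
    ultimately show ?thesis
      using inj_onD[OF forg_inj] by simp
  qed
  \<comment> \<open>The image of a constant map is a singleton only over a nonempty domain; the zero
    arrow is a member.\<close>
  have nonempty: "carrier (coh S (dm S j) (pullO S j A) (d - 1)) \<noteq> {}"
    using U.zerom_Hom[OF U.unt_Obj U.shO_Obj[OF jA]] by (simp add: coh_def HomG_def) blast
  have "secondary_group S j R A d =
      (\<lambda>_. \<one>\<^bsub>?HX\<^esub>) ` carrier (coh S (dm S j) (pullO S j A) (d - 1))"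
    unfolding secondary_group_def using delta_zero by (rule image_cong[OF refl])
  then have secondary: "secondary_group S j R A d = {\<one>\<^bsub>?HX\<^esub>}"
    using nonempty by (simp only: image_constant_conv if_False)
  \<comment> \<open>The torsor is the image of a one-element set, hence itself a singleton, and
    \<open>the_elem\<close> returns its element.\<close>
  have torsor: "localisation_torsor S i R A d c =
      {supp_adj S i R A d (Th d (euler_quotient S i A r e d (restr S i A d c)))}"
    by (simp add: localisation_torsor_def lifts)
  show ?thesis
    by (intro conjI secondary ex1 lifts) (simp_all add: torsor localised_class_def)
qed

end
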